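(* Let $x_0>0$ and let $\phi$ be a function on $[x_0,\infty)$ satisfying Assumption 1 (stated in the context). Let $X\sim F$ be a random variable with values in $\mathbb{R}$ having finite moments of all positive integer orders, and let $F$ be absolutely continuous on the set $\mathbb{R}_{x_0}=\mathbb{R}\setminus(-x_0,x_0)$ with density $F'(x)=f(x)>0$ on $\mathbb{R}_{x_0}$. Assume that $$\limsup_{|x|\to\infty}\frac{f(x+\mathrm{sign}(x)\,\phi(|x|))}{f(x)}<1.$$ Then the moments of $X$ satisfy Carleman's condition $$\sum_{n=1}^{\infty}\left(\mathsf{E}[X^{2n}]\right)^{-1/(2n)}=\infty,$$ and hence $X$ is M-det on $\mathbb{R}$. Moreover, both $X^2$ and $|X|$ are also M-det on $\mathbb{R}$ and on $\mathbb{R}_+$.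
   Context: $\mathbb{R}_+=[0,\infty)$. $X\sim F$ means that the random variable $X$ has distribution (function) $F$. Finite moments means $\mathsf{E}[|X|^n]<\infty$ for all $n\in\mathbb{N}=\{1,2,\ldots\}$. $\mathrm{sign}(x)=1$ if $x\ge 0$ and $\mathrm{sign}(x)=-1$ if $x<0$. The distribution $F$ is arbitrary on $(-x_0,x_0)$; only its restriction to $\mathbb{R}_{x_0}$ is assumed absolutely continuous. M-determinacy: a random variable with finite moments of all orders and values in $\mathbb{R}$ is M-det (moment-determinate) on $\mathbb{R}$ if no probability distribution on $\mathbb{R}$ other than its own has the same moment sequence (moments of all orders $n\in\mathbb{N}$). A random variable with values in $\mathbb{R}_+$ is M-det on $\mathbb{R}_+$ if no probability distribution on $\mathbb{R}_+$ other than its own has the same moment sequence. Assumption 1 on $\phi$: $\phi$ is a non-negative differentiable function on $[x_0,\infty)$, with $x_0>0$; the function $y=y(x)=x+\phi(x)$ is strictly increasing in $x$, with inverse function $x(y)$ on $[y_0,\infty)$, where $y_0=y(x_0)$; and the function $\varphi(y)=y-x(y)$ satisfies, for some constants $C_+>0$ and $y_*\ge y_0$: (a) $\varphi'(y)\in[0,1]$ for $y\ge y_*$; (b) $\varphi(y)\le C_+\log y$ for $y\ge y_*$; (c) $y\,\varphi'(y)\le C_+$ for $y\ge y_*$. *)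

theory Defs
  imports "HOL-Probability.Probability"
begin

definition rsign :: "real \<Rightarrow> real" where
  "rsign x = (if x \<ge> 0 then 1 else -1)"  \<comment> \<open>unlike \<^const>\<open>sgn\<close>, the value at 0 is 1\<close>

definition outer_part :: "real \<Rightarrow> real set" where
  "outer_part x0 = UNIV - {-x0<..<x0}"

definition shift_map :: "(real \<Rightarrow> real) \<Rightarrow> real \<Rightarrow> real" where
  "shift_map \<phi> x = x + \<phi> x"

text \<open>
  With \<open>x(y)\<close> the inverse of \<open>y(x) = x + \<phi>(x)\<close>, this is \<open>y - x(y)\<close>; it is meaningful for
  \<open>y \<ge> x0 + \<phi>(x0)\<close> only.
\<close>

definition back_shift :: "real \<Rightarrow> (real \<Rightarrow> real) \<Rightarrow> real \<Rightarrow> real" where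
  "back_shift x0 \<phi> y = y - the_inv_into {x0..} (shift_map \<phi>) y"

text \<open>
  Derivatives are taken within the half-lines on which the functions live, so they are one-sided
  at the left endpoint and two-sided elsewhere. The witness \<open>d\<close> is the unique value of the
  derivative of \<^term>\<open>back_shift x0 \<phi>\<close> at \<open>y\<close>.
\<close>

definition shift_assumption :: "real \<Rightarrow> (real \<Rightarrow> real) \<Rightarrow> bool" where
  "shift_assumption x0 \<phi> \<longleftrightarrow>
     x0 > 0 \<and>
     (\<forall>x\<ge>x0. \<phi> x \<ge> 0) \<and>
     \<phi> differentiable_on {x0..} \<and>
     strict_mono_on {x0..} (shift_map \<phi>) \<and>
     (\<exists>C>0. \<exists>ystar\<ge>shift_map \<phi> x0. \<forall>y\<ge>ystar.
        back_shift x0 \<phi> y \<le> C * ln y \<and>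
        (\<exists>d. (back_shift x0 \<phi> has_real_derivative d) (at y within {shift_map \<phi> x0..}) \<and>
             d \<in> {0..1} \<and> y * d \<le> C))"

text \<open>
  The restriction of \<open>F\<close> to \<open>S\<close> is absolutely continuous with respect to Lebesgue measure, with
  density \<open>f\<close>; nothing is required of \<open>F\<close> or \<open>f\<close> outside \<open>S\<close>. The function \<open>f\<close> is meant to be
  nonnegative on \<open>S\<close>, because \<^const>\<open>ennreal\<close> truncates negative values to 0.
\<close>

definition has_density_on :: "real measure \<Rightarrow> (real \<Rightarrow> real) \<Rightarrow> real set \<Rightarrow> bool" where
  "has_density_on F f S \<longleftrightarrow>
     set_borel_measurable borel S f \<and>
     (\<forall>A\<in>sets borel. A \<subseteq> S \<longrightarrow> emeasure F A = (\<integral>\<^sup>+x\<in>A. ennreal (f x) \<partial>lborel))"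

definition finite_moments :: "real measure \<Rightarrow> bool" where
  "finite_moments F \<longleftrightarrow> (\<forall>n\<ge>1. integrable F (\<lambda>x. \<bar>x\<bar> ^ n))"

definition distribution_on :: "real set \<Rightarrow> real measure \<Rightarrow> bool" where
  "distribution_on S F \<longleftrightarrow> real_distribution F \<and> (AE x in F. x \<in> S)"

definition same_moments :: "real measure \<Rightarrow> real measure \<Rightarrow> bool" where
  "same_moments F G \<longleftrightarrow> (\<forall>n\<ge>1. (\<integral>x. x ^ n \<partial>F) = (\<integral>x. x ^ n \<partial>G))"

text \<open>
  The competitor \<open>G\<close> has to have finite moments explicitly, since a Bochner integral that does
  not exist is 0.
\<close>

definition M_det_distr :: "real set \<Rightarrow> real measure \<Rightarrow> bool" where
  "M_det_distr S F \<longleftrightarrow>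
     distribution_on S F \<and> finite_moments F \<and>
     (\<forall>G. distribution_on S G \<and> finite_moments G \<and> same_moments F G \<longrightarrow> G = F)"

definition M_det_on :: "real set \<Rightarrow> 'a measure \<Rightarrow> ('a \<Rightarrow> real) \<Rightarrow> bool" where
  "M_det_on S M X \<longleftrightarrow> M_det_distr S (distr M borel X)"

text \<open>
  The series has nonnegative terms and is summed in \<^typ>\<open>ennreal\<close>; its index is shifted by one,
  so that it starts with the second moment. As \<open>0 powr a = 0\<close>, the condition is meaningful only
  if the even moments are positive, that is, if \<open>X\<close> is not almost surely 0.
\<close>

definition carleman_condition :: "'a measure \<Rightarrow> ('a \<Rightarrow> real) \<Rightarrow> bool" where
  "carleman_condition M X \<longleftrightarrow>
     (\<Sum>n. ennreal ((\<integral>\<omega>. X \<omega> ^ (2 * Suc n) \<partial>M) powr (- 1 / real (2 * Suc n)))) = \<infinity>"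

end

theory Submission
  imports Defs "HOL-Real_Asymp.Real_Asymp"
begin

text \<open>
  Everything follows from one estimate: for the nodes \<open>\<nu> k = A (k + 2) ln (k + 2)\<close> with \<open>A\<close> large,
  the expectations of \<open>\<Prod>k<N. 1 + X\<^sup>2 / (\<nu> k)\<^sup>2\<close> are bounded uniformly in \<open>N\<close>. The nodes are sparse
  enough for this to hold, but dense enough that \<open>\<Sum>k. 1 / \<nu> k\<close> diverges.

  Why the estimate holds (\<open>node_product_tail_bounded\<close>). Up to a factor, the logarithmic derivative of
  the product is \<open>\<Sum>k. x / (x\<^sup>2 + (\<nu> k)\<^sup>2)\<close>, which is of order \<open>1 / (A ln x)\<close> uniformly in \<open>N\<close>
  (\<open>sum_log_node_kernel_le\<close>). The step from \<open>x\<close> to \<open>y = x + \<phi> x\<close> has length at most \<open>C ln y\<close>, so it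
  multiplies the product by at most \<open>exp (192 C / A)\<close>, which is close to 1 when \<open>A\<close> is large. The density,
  on the other hand, drops by a fixed factor below 1, and the substitution \<open>y \<mapsto> x\<close> has derivative close
  to 1. Hence the integral of product times density over a half-line is at most its integral over a
  bounded interval plus a fixed fraction, below 1, of itself. It is finite because all moments are, so
  this fraction can be absorbed (\<open>integral_le_if_shift_contracts\<close>).

  Why the estimate suffices. Since \<open>x ^ (2 * n) \<le> (\<nu> n) ^ (2 * n) * (\<Prod>k<n. 1 + x\<^sup>2 / (\<nu> k)\<^sup>2)\<close>, the
  \<open>2 n\<close>-th root of the moment of order \<open>2 n\<close> is at most a constant times \<open>\<nu> n\<close>, and Carleman's
  condition follows from the divergence of \<open>\<Sum>k. 1 / \<nu> k\<close>. Determinacy is obtained from the same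
  products. The polynomial \<open>Q z = \<Prod>k<N. 1 - \<i> z / \<nu> k\<close> satisfies
  \<open>\<bar>Q x\<bar>\<^sup>2 = \<Prod>k<N. 1 + x\<^sup>2 / (\<nu> k)\<^sup>2\<close> for real \<open>x\<close>, so its mean square under the law of \<open>X\<close> is bounded in
  \<open>N\<close>, whereas \<open>\<bar>Q w\<bar> \<ge> 1 + Im w * (\<Sum>k<N. 1 / \<nu> k)\<close> is unbounded for every \<open>w\<close> in the upper
  half-plane. If \<open>G\<close> has the same moments as the law \<open>F\<close> of \<open>X\<close>, then \<open>\<bar>Q w\<bar>\<close> times the difference of the
  Cauchy transforms of \<open>F\<close> and \<open>G\<close> at \<open>w\<close> is controlled by the mean square of \<open>Q\<close>
  (\<open>cauchy_transform_diff_bound\<close>). Thus the transforms agree on the upper half-plane, and \<open>F = G\<close> by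
  Stieltjes inversion (\<open>cauchy_transform_inject\<close>).

  The law of \<open>\<bar>X\<bar>\<close> gives the products the same expectation, so the argument applies to it verbatim. For
  \<open>X\<^sup>2\<close> the even part \<open>E\<close> of \<open>Q\<close>, with \<open>2 * E (z\<^sup>2) = Q z + Q (- z)\<close>, replaces \<open>Q\<close>: on the nonnegative
  half-line \<open>\<bar>E (x\<^sup>2)\<bar> \<le> \<bar>Q x\<bar>\<close>, while at \<open>w = v\<^sup>2\<close> with \<open>Im v > 0\<close> the term \<open>Q v\<close> is unbounded and
  \<open>Q (- v)\<close> stays bounded. As \<open>w\<close> ranges over the whole upper half-plane, competitors of the law of
  \<open>X\<^sup>2\<close> that charge the negative half-line are excluded as well.
\<close>

section \<open>Logarithmic nodes and their products\<close>

definition log_node :: "nat \<Rightarrow> real" where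
  "log_node k = real (k + 2) * ln (real (k + 2))"

lemma log_node_ge: "real (k + 2) / 2 \<le> log_node k"
proof -
  have "1/2 \<le> ln (real (k+2))"
  proof -
    have "1 / 2 \<le> ln (2::real)" using ln_ge_iff[of 2 "1/2"] exp_half_le2 by simp
    also have "\<dots> \<le> ln (real (k+2))" by simp
    finally show ?thesis .
  qed
  from mult_left_mono[OF this, of "real (k+2)"] show ?thesis by (simp add: log_node_def)
qed

lemma log_node_pos: "0 < log_node k"
  using log_node_ge[of k] by (smt (verit) divide_pos_pos of_nat_0_less_iff add_gr_0 zero_less_numeral)

lemma log_node_mono: "i \<le> j \<Longrightarrow> log_node i \<le> log_node j"
  unfolding log_node_def by (intro mult_mono) auto

text \<open>
  The divergence of \<open>\<Sum>m. 1 / (m ln m)\<close> is read off by telescoping: its terms dominate the increments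
  of \<open>ln (ln m)\<close>.
\<close>

lemma sum_inverse_log_node_not_summable: "\<not> summable (\<lambda>k. 1 / log_node k)"
proof
  assume s: "summable (\<lambda>k. 1 / log_node k)"
  have le: "ln (ln (real (Suc k + 2))) - ln (ln (real (k + 2))) \<le> 1 / log_node k" for k
  proof -
    define m where "m = real (k + 2)"
    have m: "m \<ge> 2" by (simp add: m_def)
    then have lp: "ln m > 0" by simp
    have a: "ln (m + 1) \<le> ln m + 1 / m"
    proof -
      have "m + 1 = m * (1 + 1 / m)" using m by (simp add: field_simps)
      then have "ln (m + 1) = ln m + ln (1 + 1 / m)"
        using m ln_mult_pos[of m "1 + 1 / m"] by (simp add: add_pos_pos)
      also have "ln (1 + 1 / m) \<le> 1 / m" using m by (intro ln_add_one_self_le_self) auto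
      finally show ?thesis by simp
    qed
    have "ln m * (1 + 1 / (m * ln m)) = ln m + 1 / m" using m lp by (simp add: field_simps)
    with a m have "ln (ln (m + 1)) \<le> ln (ln m * (1 + 1 / (m * ln m)))" by (intro ln_mono) auto
    also have "\<dots> = ln (ln m) + ln (1 + 1 / (m * ln m))"
      using m lp by (intro ln_mult_pos) (auto intro!: add_pos_pos)
    also have "ln (1 + 1 / (m * ln m)) \<le> 1 / (m * ln m)"
      using m lp by (intro ln_add_one_self_le_self) auto
    finally show ?thesis by (simp add: m_def log_node_def add.commute)
  qed
  have bd: "ln (ln (real (N + 2))) \<le> (\<Sum>k. 1 / log_node k) + ln (ln 2)" for N
  proof -
    have "ln (ln (real (N + 2))) - ln (ln (real (0 + 2)))
        = (\<Sum>k<N. ln (ln (real (Suc k + 2))) - ln (ln (real (k + 2))))"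
      by (rule sum_lessThan_telescope[symmetric])
    also have "\<dots> \<le> (\<Sum>k<N. 1 / log_node k)" by (intro sum_mono le)
    also have "\<dots> \<le> (\<Sum>k. 1 / log_node k)"
      by (intro sum_le_suminf s) (auto intro: less_imp_le[OF log_node_pos])
    finally show ?thesis by simp
  qed
  have "filterlim (\<lambda>N. ln (ln (real (N + 2)))) at_top sequentially"
    by (intro filterlim_compose[OF ln_at_top] filterlim_compose[OF filterlim_real_sequentially]
         filterlim_add_const_nat_at_top)
  then have "eventually (\<lambda>N. (\<Sum>k. 1 / log_node k) + ln (ln 2) < ln (ln (real (N + 2)))) sequentially"
    by (simp add: filterlim_at_top_dense)
  then obtain N where "(\<Sum>k. 1 / log_node k) + ln (ln 2) < ln (ln (real (N + 2)))"
    by (auto simp: eventually_sequentially)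
  then show False using bd[of N] by linarith
qed

lemma summable_inverse_square_log_node: "summable (\<lambda>k. 1 / (log_node k)\<^sup>2)"
proof (rule summable_comparison_test')
  show "summable (\<lambda>k. 4 * (1 / real (Suc k) ^ 2))"
    using inverse_squares_sums by (intro summable_mult) (auto simp: sums_iff)
next
  fix k :: nat
  have "real (Suc k) / 2 \<le> log_node k" using log_node_ge[of k] by simp
  then have "(real (Suc k) / 2)\<^sup>2 \<le> (log_node k)\<^sup>2" by (intro power_mono) auto
  then have "1 / (log_node k)\<^sup>2 \<le> 1 / (real (Suc k) / 2)\<^sup>2"
    by (intro divide_left_mono) (auto intro!: mult_pos_pos simp: log_node_pos zero_less_power)
  also have "\<dots> = 4 * (1 / real (Suc k) ^ 2)" by (simp add: power2_eq_square)
  finally show "norm (1 / (log_node k)\<^sup>2) \<le> 4 * (1 / real (Suc k) ^ 2)" by simp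
qed

text \<open>
  With \<open>m = k + 2\<close> and \<open>K = z / ln z\<close>, the terms with \<open>m \<le> K\<close> are at most \<open>1 / z\<close>, and there are about
  \<open>K\<close> of them. For \<open>m > K\<close> the node is at least \<open>m ln z / 2\<close>, since \<open>ln K \<ge> ln z / 2\<close>, and the terms are at
  most \<open>4 K / (m\<^sup>2 ln z)\<close>; their sum is again of order \<open>1 / ln z\<close>.
\<close>

lemma sum_log_node_kernel_le:
  fixes z :: real
  assumes z: "1 < z"
  shows "(\<Sum>k<N. z / (z\<^sup>2 + (log_node k)\<^sup>2)) \<le> 16 / ln z"
proof -
  define t where "t = ln z"
  define K where "K = z / t"
  have t: "t > 0" using z by (simp add: t_def)
  have K: "K > 0" using t z by (simp add: K_def)
  have zK: "z = K * t" using t by (simp add: K_def)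
  have lnK: "t / 2 \<le> ln K"
  proof -
    have "ln K = t - ln t" using z t by (simp add: K_def ln_div t_def)
    moreover have "ln t \<le> t / 2"
    proof -
      have "ln (t / 2) \<le> t / 2 - 1" using t by (intro ln_le_minus_one) auto
      moreover have "ln (t / 2) = ln t - ln 2" using t by (simp add: ln_div)
      moreover have "ln 2 \<le> (1::real)" using ln_le_minus_one[of "2::real"] by simp
      ultimately show ?thesis by linarith
    qed
    ultimately show ?thesis by linarith
  qed
  \<comment> \<open>The increments of \<open>U\<close> are at least \<open>4 / (K t)\<close> for \<open>m \<le> K\<close> and \<open>4 K / (t m\<^sup>2)\<close> for \<open>m > K\<close>, so that they
     dominate the terms in both ranges; the telescoped sum then bounds both parts at once.\<close>
  define U where "U k = - (16 * K / t) / (real (k + 1) + K)" for k :: nat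
  have step: "z / (z\<^sup>2 + (log_node k)\<^sup>2) \<le> U (Suc k) - U k" for k
  proof -
    define m where "m = real (k + 2)"
    have m: "m \<ge> 2" by (simp add: m_def)
    have U: "U (Suc k) - U k = 16 * K / (t * ((m - 1 + K) * (m + K)))"
    proof -
      have a: "real (k + 1) + K = m - 1 + K" "real (Suc k + 1) + K = m + K" by (auto simp: m_def)
      have b: "m - 1 + K \<noteq> 0" "m + K \<noteq> 0" using m K by auto
      have "U (Suc k) - U k = 16 * K / t * (1 / (m - 1 + K) - 1 / (m + K))"
        unfolding U_def a by (simp add: algebra_simps)
      also have "1 / (m - 1 + K) - 1 / (m + K) = 1 / ((m - 1 + K) * (m + K))"
        using b by (simp add: field_simps)
      finally show ?thesis by simp
    qed
    show ?thesis
    proof (cases "m \<le> K")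
      case True
      have "z / (z\<^sup>2 + (log_node k)\<^sup>2) \<le> z / z\<^sup>2"
        using z by (intro divide_left_mono) (auto intro!: mult_pos_pos add_pos_nonneg)
      also have "\<dots> = 16 * K / (t * (16 * K\<^sup>2))"
        using z K t by (simp add: power2_eq_square zK)
      also have "\<dots> \<le> 16 * K / (t * ((m - 1 + K) * (m + K)))"
      proof -
        have "(m - 1 + K) * (m + K) \<le> (2 * K) * (2 * K)"
          using True m K by (intro mult_mono) auto
        also have "\<dots> \<le> 16 * K\<^sup>2" by (simp add: power2_eq_square)
        finally show ?thesis using t K m
          by (intro divide_left_mono mult_left_mono) (auto intro!: mult_pos_pos)
      qed
      finally show ?thesis by (simp add: U)
    next
      case False
      then have mK: "K < m" by simp
      have "t / 2 \<le> ln m" using lnK mK K m by (smt (verit) ln_mono)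
      then have "m * (t / 2) \<le> log_node k"
        unfolding log_node_def m_def[symmetric] using m by (intro mult_left_mono) auto
      then have "(m * (t / 2))\<^sup>2 \<le> z\<^sup>2 + (log_node k)\<^sup>2"
        using m t by (intro add_increasing power_mono) auto
      then have "z / (z\<^sup>2 + (log_node k)\<^sup>2) \<le> z / (m * (t / 2))\<^sup>2"
        using z m t by (intro divide_left_mono) (auto intro!: mult_pos_pos add_pos_nonneg)
      also have "\<dots> = 16 * K / (t * (4 * m\<^sup>2))"
        using m t by (simp add: zK power2_eq_square field_simps)
      also have "\<dots> \<le> 16 * K / (t * ((m - 1 + K) * (m + K)))"
      proof -
        have "(m - 1 + K) * (m + K) \<le> (2 * m) * (2 * m)"
          using mK m K by (intro mult_mono) auto
        also have "\<dots> = 4 * m\<^sup>2" by (simp add: power2_eq_square)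
        finally show ?thesis using t K m
          by (intro divide_left_mono mult_left_mono) (auto intro!: mult_pos_pos)
      qed
      finally show ?thesis by (simp add: U)
    qed
  qed
  have "(\<Sum>k<N. z / (z\<^sup>2 + (log_node k)\<^sup>2)) \<le> (\<Sum>k<N. U (Suc k) - U k)"
    by (intro sum_mono step)
  also have "\<dots> = U N - U 0" by (rule sum_lessThan_telescope)
  also have "\<dots> \<le> - U 0" using K t by (simp add: U_def)
  also have "\<dots> = 16 / t * (K / (1 + K))" by (simp add: U_def)
  also have "\<dots> \<le> 16 / t" using K t by (intro mult_left_le) auto
  finally show ?thesis by (simp add: t_def)
qed

definition node_product :: "(nat \<Rightarrow> real) \<Rightarrow> nat \<Rightarrow> real \<Rightarrow> real" where
  "node_product \<nu> N x = (\<Prod>k<N. 1 + (x / \<nu> k)\<^sup>2)"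

lemma node_product_ge_1: "1 \<le> node_product \<nu> N x"
  unfolding node_product_def by (intro prod_ge_1) auto

lemma node_product_uminus [simp]: "node_product \<nu> N (- x) = node_product \<nu> N x"
  by (simp add: node_product_def)

lemma node_product_abs [simp]: "node_product \<nu> N \<bar>x\<bar> = node_product \<nu> N x"
  by (simp add: node_product_def power_divide)

lemma node_product_mono: "\<bar>x\<bar> \<le> \<bar>y\<bar> \<Longrightarrow> node_product \<nu> N x \<le> node_product \<nu> N y"
  unfolding node_product_def power_divide
  by (intro prod_mono conjI add_left_mono divide_right_mono) (auto simp: abs_le_square_iff)

lemma node_product_le_exp:
  assumes "summable (\<lambda>k. 1 / (\<nu> k)\<^sup>2)"
  shows "node_product \<nu> N x \<le> exp (x\<^sup>2 * (\<Sum>k. 1 / (\<nu> k)\<^sup>2))"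
proof -
  have "node_product \<nu> N x \<le> (\<Prod>k<N. exp ((x / \<nu> k)\<^sup>2))"
    unfolding node_product_def by (intro prod_mono) (auto simp: exp_ge_add_one_self)
  also have "\<dots> = exp (x\<^sup>2 * (\<Sum>k<N. 1 / (\<nu> k)\<^sup>2))"
    by (simp add: exp_sum sum_distrib_left power_divide)
  also have "\<dots> \<le> exp (x\<^sup>2 * (\<Sum>k. 1 / (\<nu> k)\<^sup>2))"
    using assms by (auto intro!: mult_left_mono sum_le_suminf)
  finally show ?thesis .
qed

lemma borel_measurable_node_product [measurable]: "node_product \<nu> N \<in> borel_measurable borel"
  unfolding node_product_def[abs_def] by measurable

text \<open>
  One factor changes by \<open>(y\<^sup>2 + l\<^sup>2) / (x\<^sup>2 + l\<^sup>2) = 1 + (y\<^sup>2 - x\<^sup>2) / (x\<^sup>2 + l\<^sup>2)\<close>, where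
  \<open>y\<^sup>2 - x\<^sup>2 = (y - x) (y + x)\<close> and \<open>y + x \<le> 3 x\<close>; it remains to use \<open>1 + t \<le> exp t\<close>.
\<close>

lemma node_product_growth:
  assumes "0 < x" "x \<le> y" "y \<le> 2 * x" and pos: "\<And>k. 0 < \<nu> k"
  shows "node_product \<nu> N y \<le> node_product \<nu> N x * exp (3 * (y - x) * (\<Sum>k<N. x / (x\<^sup>2 + (\<nu> k)\<^sup>2)))"
proof -
  have "1 + (y / \<nu> k)\<^sup>2 \<le> (1 + (x / \<nu> k)\<^sup>2) * exp (3 * (y - x) * (x / (x\<^sup>2 + (\<nu> k)\<^sup>2)))" for k
  proof -
    let ?l = "\<nu> k"
    have l: "?l > 0" by (rule pos)
    have s: "x\<^sup>2 + ?l\<^sup>2 > 0" using l by (intro add_nonneg_pos) auto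
    have "y\<^sup>2 - x\<^sup>2 \<le> 3 * (y - x) * x"
    proof -
      have "y\<^sup>2 - x\<^sup>2 = (y - x) * (y + x)" by (simp add: power2_eq_square algebra_simps)
      also have "\<dots> \<le> (y - x) * (3 * x)" using assms by (intro mult_left_mono) auto
      also have "\<dots> = 3 * (y - x) * x" by (simp only: mult_ac)
      finally show ?thesis .
    qed
    then have "(y\<^sup>2 - x\<^sup>2) / (x\<^sup>2 + ?l\<^sup>2) \<le> 3 * (y - x) * (x / (x\<^sup>2 + ?l\<^sup>2))"
      using s by (simp add: divide_right_mono)
    then have "1 + (y\<^sup>2 - x\<^sup>2) / (x\<^sup>2 + ?l\<^sup>2) \<le> exp (3 * (y - x) * (x / (x\<^sup>2 + ?l\<^sup>2)))"
      using exp_ge_add_one_self by (smt (verit))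
    then have "(1 + (x / ?l)\<^sup>2) * (1 + (y\<^sup>2 - x\<^sup>2) / (x\<^sup>2 + ?l\<^sup>2))
      \<le> (1 + (x / ?l)\<^sup>2) * exp (3 * (y - x) * (x / (x\<^sup>2 + ?l\<^sup>2)))"
      by (intro mult_left_mono) auto
    moreover have "(1 + (x / ?l)\<^sup>2) * (1 + (y\<^sup>2 - x\<^sup>2) / (x\<^sup>2 + ?l\<^sup>2)) = 1 + (y / ?l)\<^sup>2"
    proof -
      have "1 + (x / ?l)\<^sup>2 = (x\<^sup>2 + ?l\<^sup>2) / ?l\<^sup>2" using l by (simp add: field_simps)
      moreover have "1 + (y\<^sup>2 - x\<^sup>2) / (x\<^sup>2 + ?l\<^sup>2) = (y\<^sup>2 + ?l\<^sup>2) / (x\<^sup>2 + ?l\<^sup>2)" 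
      proof -
        have ne: "x\<^sup>2 + ?l\<^sup>2 \<noteq> 0" using s by linarith
        have "y\<^sup>2 + ?l\<^sup>2 = (x\<^sup>2 + ?l\<^sup>2) + (y\<^sup>2 - x\<^sup>2)" by simp
        then show ?thesis by (simp only: add_divide_distrib[of "x\<^sup>2 + ?l\<^sup>2"] divide_self[OF ne])
      qed
      moreover have "1 + (y / ?l)\<^sup>2 = (y\<^sup>2 + ?l\<^sup>2) / ?l\<^sup>2" using l by (simp add: field_simps)
      moreover have "a / b * (c / a) = c / b" if "a > 0" for a b c :: real using that by simp
      ultimately show ?thesis using s by (simp only:)
    qed
    ultimately show ?thesis by simp
  qed
  then have "node_product \<nu> N y
      \<le> (\<Prod>k<N. (1 + (x / \<nu> k)\<^sup>2) * exp (3 * (y - x) * (x / (x\<^sup>2 + (\<nu> k)\<^sup>2))))"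
    unfolding node_product_def by (intro prod_mono) auto
  also have "\<dots> = node_product \<nu> N x * exp (3 * (y - x) * (\<Sum>k<N. x / (x\<^sup>2 + (\<nu> k)\<^sup>2)))"
    by (simp only: prod.distrib node_product_def exp_sum[symmetric] sum_distrib_left finite_lessThan)
  finally show ?thesis .
qed

text \<open>
  Scaling the nodes by \<open>A\<close> turns the kernel sum at \<open>x\<close> into \<open>1 / A\<close> times the unscaled sum at \<open>x / A\<close>. This
  gains the factor \<open>1 / A\<close>, and \<open>x \<ge> A\<^sup>2\<close> ensures that \<open>ln (x / A)\<close> is still at least \<open>ln x / 2\<close>. A step
  of logarithmic length therefore costs a factor that can be brought as close to 1 as desired. The number
  192 is \<open>3 * 2 * 32\<close>: the 3 of the previous lemma, \<open>ln y \<le> 2 ln x\<close>, and twice the 16 of the kernel sum.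
\<close>

lemma node_product_log_node_growth:
  fixes A C x y :: real
  assumes A: "2 \<le> A" and x: "A\<^sup>2 \<le> x" and y: "x \<le> y" "y \<le> 2 * x" and C: "0 \<le> C" "y - x \<le> C * ln y"
  shows "node_product (\<lambda>k. A * log_node k) N y \<le> exp (192 * C / A) * node_product (\<lambda>k. A * log_node k) N x"
proof -
  have "4 \<le> A\<^sup>2" using A power_mono[of 2 A 2] by simp
  then have x4: "4 \<le> x" using x by simp
  have "2 * A \<le> A * A" using A by (intro mult_right_mono) auto
  then have Ax: "2 * A \<le> x" using x by (simp add: power2_eq_square)
  have lnx: "0 < ln x" using x4 by simp
  have z: "1 < x / A" using A Ax by (simp add: field_simps)
  have lnz: "ln x / 2 \<le> ln (x / A)"
  proof -
    have "2 * ln A = ln (A\<^sup>2)" using A by (simp add: ln_realpow)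
    also have "\<dots> \<le> ln x" using x A x4 by (intro ln_mono) auto
    finally show ?thesis using A x4 by (simp add: ln_div)
  qed
  have lny: "ln y \<le> 2 * ln x"
  proof -
    have "2 * x \<le> x * x" using x4 by (intro mult_right_mono) auto
    then have "y \<le> x\<^sup>2" using y by (simp add: power2_eq_square)
    then have "ln y \<le> ln (x\<^sup>2)" using y x4 by (intro ln_mono) auto
    then show ?thesis using x4 by (simp add: ln_realpow)
  qed
  let ?S = "\<Sum>k<N. x / (x\<^sup>2 + (A * log_node k)\<^sup>2)"
  have S: "?S \<le> 32 / (A * ln x)"
  proof -
    have "?S = (1 / A) * (\<Sum>k<N. (x / A) / ((x / A)\<^sup>2 + (log_node k)\<^sup>2))"
    proof -
      have "x / (x\<^sup>2 + (A * log_node k)\<^sup>2) = (1 / A) * ((x / A) / ((x / A)\<^sup>2 + (log_node k)\<^sup>2))" for k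
      proof -
        have "(x / A)\<^sup>2 + (log_node k)\<^sup>2 = (x\<^sup>2 + (A * log_node k)\<^sup>2) / A\<^sup>2"
          using A by (simp add: field_simps)
        then show ?thesis using A by (simp add: power2_eq_square)
      qed
      then show ?thesis by (simp only: sum_distrib_left)
    qed
    also have "\<dots> \<le> (1 / A) * (16 / ln (x / A))"
      using A by (intro mult_left_mono sum_log_node_kernel_le z) auto
    also have "\<dots> \<le> (1 / A) * (16 / (ln x / 2))"
      using A lnz lnx z by (intro mult_left_mono divide_left_mono mult_pos_pos) auto
    finally show ?thesis by (simp add: mult.commute)
  qed
  have "3 * (y - x) * ?S \<le> 3 * (C * (2 * ln x)) * (32 / (A * ln x))"
    using y C lny S A lnx x4
    by (intro mult_mono order_trans[OF C(2)] mult_left_mono) (auto intro!: sum_nonneg divide_nonneg_nonneg)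
  also have "\<dots> = 192 * C / A" using lnx by simp
  finally have e: "3 * (y - x) * ?S \<le> 192 * C / A" .
  have "node_product (\<lambda>k. A * log_node k) N y \<le> node_product (\<lambda>k. A * log_node k) N x * exp (3 * (y - x) * ?S)"
    using y x4 A by (intro node_product_growth) (auto simp: log_node_pos)
  also have "\<dots> \<le> node_product (\<lambda>k. A * log_node k) N x * exp (192 * C / A)"
    using e order_trans[OF zero_le_one node_product_ge_1] by (intro mult_left_mono) auto
  finally show ?thesis by (simp add: mult.commute)
qed

section \<open>The Cauchy transform\<close>

lemma complex_inverse_Im_bound:
  assumes "0 < Im w"
  shows "norm (1 / (complex_of_real u - w)) \<le> 1 / Im w"
proof -
  have "Im w \<le> norm (complex_of_real u - w)"
    using abs_Im_le_cmod[of "complex_of_real u - w"] by simp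
  then show ?thesis using assms by (simp add: norm_divide frac_le)
qed

definition cauchy_transform :: "real measure \<Rightarrow> complex \<Rightarrow> complex" where
  "cauchy_transform F w = (\<integral>u. 1 / (complex_of_real u - w) \<partial>F)"

lemma (in real_distribution) integrable_cauchy_kernel:
  assumes "0 < Im w"
  shows "integrable M (\<lambda>u. 1 / (complex_of_real u - w))"
  by (rule integrable_const_bound[where B = "1 / Im w"]) (use complex_inverse_Im_bound[OF assms] in auto)

lemma integrable_power_if_finite_moments:
  assumes "real_distribution F" "finite_moments F"
  shows "integrable F (\<lambda>x. x ^ n)"
proof -
  interpret real_distribution F by fact
  show ?thesis
  proof (cases "n = 0")
    case False
    then have i: "integrable F (\<lambda>x. \<bar>x\<bar> ^ n)" using assms by (simp add: finite_moments_def)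
    show ?thesis by (rule Bochner_Integration.integrable_bound[OF i]) (auto simp: power_abs)
  qed simp
qed

lemma integrable_complex_poly:
  fixes p :: "complex poly"
  assumes "real_distribution F" "finite_moments F"
  shows "integrable F (\<lambda>x. poly p (complex_of_real x))"
proof -
  have "integrable F (\<lambda>x. coeff p i * complex_of_real (x ^ i))" for i
    using integrable_power_if_finite_moments[OF assms] by (intro integrable_mult_right integrable_of_real)
  then show ?thesis by (simp add: poly_altdef)
qed

lemma integral_complex_poly_eq:
  fixes p :: "complex poly"
  assumes F: "real_distribution F" "finite_moments F" and G: "real_distribution G" "finite_moments G"
    and m: "same_moments F G"
  shows "(\<integral>x. poly p (complex_of_real x) \<partial>F) = (\<integral>x. poly p (complex_of_real x) \<partial>G)"
proof -
  interpret F: real_distribution F by fact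
  interpret G: real_distribution G by fact
  have i: "integrable F (\<lambda>x. coeff p i * complex_of_real (x ^ i))"
    "integrable G (\<lambda>x. coeff p i * complex_of_real (x ^ i))" for i
    by (intro integrable_mult_right integrable_of_real integrable_power_if_finite_moments F G)+
  have m': "(\<integral>x. x ^ i \<partial>F) = (\<integral>x. x ^ i \<partial>G)" for i
  proof (cases "i = 0")
    case True
    then show ?thesis using F.prob_space G.prob_space by simp
  next
    case False then show ?thesis using m by (simp add: same_moments_def)
  qed
  have "(\<integral>x. coeff p i * complex_of_real (x ^ i) \<partial>F) = (\<integral>x. coeff p i * complex_of_real (x ^ i) \<partial>G)" for i
    unfolding integral_mult_right_zero integral_complex_of_real m' ..
  then show ?thesis
    unfolding poly_altdef of_real_power[symmetric]
    by (simp only: Bochner_Integration.integral_sum i)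
qed

lemma norm_poly_sq_eq_poly:
  fixes p :: "complex poly"
  shows "complex_of_real ((norm (poly p (complex_of_real x)))\<^sup>2)
       = poly (p * map_poly cnj p) (complex_of_real x)"
proof -
  have "poly (map_poly cnj p) (complex_of_real x) = cnj (poly p (complex_of_real x))"
    by simp
  then show ?thesis by (simp only: poly_mult complex_norm_square)
qed

text \<open>
  The polynomial \<open>r = (p - p w) / (u - w)\<close> has the same integral under \<open>F\<close> and \<open>G\<close>. Hence \<open>p w\<close> times the
  difference of the Cauchy transforms equals the difference of the integrals of \<open>p u / (u - w)\<close>, and these
  are controlled by \<open>\<bar>p\<bar>\<close>. The mean square of \<open>p\<close> is the integral of a polynomial on the real line, so a
  bound under \<open>F\<close> is also one under \<open>G\<close>.
\<close>

lemma cauchy_transform_diff_bound: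
  fixes p :: "complex poly"
  assumes F: "real_distribution F" "finite_moments F" and G: "real_distribution G" "finite_moments G"
    and m: "same_moments F G" and w: "0 < Im w"
    and B: "(\<integral>x. (norm (poly p (complex_of_real x)))\<^sup>2 \<partial>F) \<le> B"
  shows "norm (poly p w) * norm (cauchy_transform F w - cauchy_transform G w) \<le> 2 * (1 + B) / Im w"
proof -
  have "[:- w, 1:] dvd p - [:poly p w:]" by (simp add: poly_eq_0_iff_dvd[symmetric])
  then obtain r where r: "p - [:poly p w:] = [:- w, 1:] * r" by (elim dvdE)
  have ptwise: "poly p (complex_of_real x) / (complex_of_real x - w)
      = poly p w * (1 / (complex_of_real x - w)) + poly r (complex_of_real x)" for x
  proof -
    have "complex_of_real x - w \<noteq> 0" using w by (auto simp: complex_eq_iff)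
    moreover have "poly p (complex_of_real x) - poly p w = (complex_of_real x - w) * poly r (complex_of_real x)"
      using arg_cong[OF r, of "\<lambda>q. poly q (complex_of_real x)"] by (simp add: algebra_simps)
    ultimately show ?thesis by (simp add: field_simps)
  qed
  define J where "J H = (\<integral>x. poly p (complex_of_real x) / (complex_of_real x - w) \<partial>H)" for H :: "real measure"
  have J: "J H = poly p w * cauchy_transform H w + (\<integral>x. poly r (complex_of_real x) \<partial>H)"
    if H: "real_distribution H" "finite_moments H" for H
    unfolding J_def ptwise cauchy_transform_def
    using real_distribution.integrable_cauchy_kernel[OF H(1) w] integrable_complex_poly[OF H, of r]
    by (simp only: Bochner_Integration.integral_add integrable_mult_right integral_mult_right_zero)
  have intsq: "integrable H (\<lambda>x. (norm (poly p (complex_of_real x)))\<^sup>2)"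
    if H: "real_distribution H" "finite_moments H" for H
    using integrable_Re[OF integrable_complex_poly[OF H, of "p * map_poly cnj p"]]
    unfolding norm_poly_sq_eq_poly[symmetric] by simp
  have sq: "(\<integral>x. (norm (poly p (complex_of_real x)))\<^sup>2 \<partial>G) = (\<integral>x. (norm (poly p (complex_of_real x)))\<^sup>2 \<partial>F)"
    using integral_complex_poly_eq[OF F G m, of "p * map_poly cnj p"]
    unfolding norm_poly_sq_eq_poly[symmetric] integral_complex_of_real of_real_eq_iff by simp
  have bd: "norm (J H) \<le> (1 + B) / Im w"
    if H: "real_distribution H" "finite_moments H"
      and BH: "(\<integral>x. (norm (poly p (complex_of_real x)))\<^sup>2 \<partial>H) \<le> B" for H
  proof -
    interpret H: real_distribution H by fact
    have "norm (J H) \<le> (\<integral>x. (1 + (norm (poly p (complex_of_real x)))\<^sup>2) / Im w \<partial>H)"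
      unfolding J_def
    proof (rule Bochner_Integration.integral_norm_bound_integral)
      show "integrable H (\<lambda>x. poly p (complex_of_real x) / (complex_of_real x - w))"
        unfolding ptwise
        by (intro Bochner_Integration.integrable_add integrable_mult_right
            H.integrable_cauchy_kernel w integrable_complex_poly H)
      show "integrable H (\<lambda>x. (1 + (norm (poly p (complex_of_real x)))\<^sup>2) / Im w)"
        using intsq[OF H] by auto
      fix x
      have a: "norm (poly p (complex_of_real x)) \<le> 1 + (norm (poly p (complex_of_real x)))\<^sup>2"
      proof -
        have "0 \<le> (norm (poly p (complex_of_real x)) - 1)\<^sup>2" by simp
        then have "2 * norm (poly p (complex_of_real x)) \<le> 1 + (norm (poly p (complex_of_real x)))\<^sup>2"
          by (simp add: power2_diff)
        then show ?thesis using norm_ge_zero[of "poly p (complex_of_real x)"] by linarith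
      qed
      have "norm (poly p (complex_of_real x) / (complex_of_real x - w))
          = norm (poly p (complex_of_real x)) * norm (1 / (complex_of_real x - w))"
        by (simp add: norm_divide)
      also have "\<dots> \<le> (1 + (norm (poly p (complex_of_real x)))\<^sup>2) * (1 / Im w)"
        by (intro mult_mono a complex_inverse_Im_bound w) auto
      finally show "norm (poly p (complex_of_real x) / (complex_of_real x - w))
          \<le> (1 + (norm (poly p (complex_of_real x)))\<^sup>2) / Im w" by simp
    qed
    also have "\<dots> = (1 + (\<integral>x. (norm (poly p (complex_of_real x)))\<^sup>2 \<partial>H)) / Im w"
      using intsq[OF H] H.prob_space by simp
    also have "\<dots> \<le> (1 + B) / Im w" using BH w by (intro divide_right_mono) auto
    finally show ?thesis .
  qed
  have "poly p w * (cauchy_transform F w - cauchy_transform G w) = J F - J G"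
    using J[OF F] J[OF G] integral_complex_poly_eq[OF F G m, of r] by (simp add: algebra_simps)
  then have "norm (poly p w) * norm (cauchy_transform F w - cauchy_transform G w) = norm (J F - J G)"
    by (simp only: norm_mult[symmetric])
  also have "\<dots> \<le> norm (J F) + norm (J G)" by (rule norm_triangle_ineq4)
  also have "\<dots> \<le> (1 + B) / Im w + (1 + B) / Im w"
    using bd[OF F B] bd[OF G] B sq by (intro add_mono) auto
  finally show ?thesis by (simp add: add_divide_distrib)
qed

text \<open>
  On a horizontal line the imaginary part of the Cauchy transform is the convolution with the Poisson
  kernel, up to the factor \<open>\<pi>\<close>. Integrating it over \<open>[a, b]\<close> gives a smoothed form of the mass of \<open>[a, b]\<close>.
\<close>

lemma Im_cauchy_kernel:
  assumes "e > 0"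
  shows "Im (1 / (complex_of_real u - Complex t e)) = e / ((t - u)\<^sup>2 + e\<^sup>2)"
  by (simp add: Im_divide power2_commute[of t u])

lemma nn_integral_poisson_kernel:
  fixes a b e u :: real
  assumes "a \<le> b" "e > 0"
  shows "(\<integral>\<^sup>+t. ennreal (e / ((t - u)\<^sup>2 + e\<^sup>2)) * indicator {a..b} t \<partial>lborel)
       = ennreal (arctan ((b - u) / e) - arctan ((a - u) / e))"
proof (rule nn_integral_FTC_Icc)
  fix t :: real
  have "((\<lambda>t. arctan ((t - u) / e)) has_real_derivative (1 / e * inverse (1 + ((t - u) / e)\<^sup>2))) (at t)"
    using assms by (auto intro!: derivative_eq_intros simp: field_simps)
  also have "1 / e * inverse (1 + ((t - u) / e)\<^sup>2) = e / ((t - u)\<^sup>2 + e\<^sup>2)"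
  proof -
    have "1 + ((t - u) / e)\<^sup>2 = ((t - u)\<^sup>2 + e\<^sup>2) / e\<^sup>2" using assms by (simp add: field_simps)
    then show ?thesis using assms by (simp add: power2_eq_square)
  qed
  finally show "((\<lambda>t. arctan ((t - u) / e)) has_real_derivative e / ((t - u)\<^sup>2 + e\<^sup>2)) (at t)" .
qed (use assms in auto)

lemma (in real_distribution) nn_integral_Im_cauchy_transform:
  assumes "a \<le> b" "e > 0"
  shows "(\<integral>\<^sup>+t. ennreal (Im (cauchy_transform M (Complex t e))) * indicator {a..b} t \<partial>lborel)
       = ennreal (\<integral>u. arctan ((b - u) / e) - arctan ((a - u) / e) \<partial>M)"
proof -
  interpret P: pair_sigma_finite lborel M ..
  have ar: "0 \<le> arctan ((b - u) / e) - arctan ((a - u) / e)" for u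
    using assms by (simp add: arctan_monotone' divide_right_mono)
  have Im: "ennreal (Im (cauchy_transform M (Complex t e))) = (\<integral>\<^sup>+u. ennreal (e / ((t - u)\<^sup>2 + e\<^sup>2)) \<partial>M)" for t
  proof -
    have i: "integrable M (\<lambda>u. 1 / (complex_of_real u - Complex t e))"
      using assms by (intro integrable_cauchy_kernel) auto
    have "Im (cauchy_transform M (Complex t e)) = (\<integral>u. e / ((t - u)\<^sup>2 + e\<^sup>2) \<partial>M)"
      unfolding cauchy_transform_def integral_Im[OF i, symmetric] Im_cauchy_kernel[OF assms(2)] ..
    moreover have "integrable M (\<lambda>u. e / ((t - u)\<^sup>2 + e\<^sup>2))"
      using integrable_Im[OF i] unfolding Im_cauchy_kernel[OF assms(2)] .
    ultimately show ?thesis using assms by (subst nn_integral_eq_integral) auto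
  qed
  have "(\<integral>\<^sup>+t. ennreal (Im (cauchy_transform M (Complex t e))) * indicator {a..b} t \<partial>lborel)
     = (\<integral>\<^sup>+t. \<integral>\<^sup>+u. ennreal (e / ((t - u)\<^sup>2 + e\<^sup>2)) * indicator {a..b} t \<partial>M \<partial>lborel)"
    unfolding Im by (subst nn_integral_multc) auto
  also have "\<dots> = (\<integral>\<^sup>+u. \<integral>\<^sup>+t. ennreal (e / ((t - u)\<^sup>2 + e\<^sup>2)) * indicator {a..b} t \<partial>lborel \<partial>M)"
    by (rule P.Fubini'[symmetric]) simp
  also have "\<dots> = (\<integral>\<^sup>+u. ennreal (arctan ((b - u) / e) - arctan ((a - u) / e)) \<partial>M)"
    by (simp add: nn_integral_poisson_kernel assms)
  also have "\<dots> = ennreal (\<integral>u. arctan ((b - u) / e) - arctan ((a - u) / e) \<partial>M)"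
  proof (rule nn_integral_eq_integral)
    show "integrable M (\<lambda>u. arctan ((b - u) / e) - arctan ((a - u) / e))"
    proof (rule integrable_const_bound[where B = pi])
      show "AE u in M. norm (arctan ((b - u) / e) - arctan ((a - u) / e)) \<le> pi"
      proof (rule AE_I2)
        fix u
        show "norm (arctan ((b - u) / e) - arctan ((a - u) / e)) \<le> pi"
          using arctan_bounded[of "(b - u) / e"] arctan_bounded[of "(a - u) / e"] by (simp add: abs_le_iff)
      qed
    qed simp
  qed (use ar in auto)
  finally show ?thesis .
qed

text \<open>
  The height \<open>1 / n\<^sup>2\<close> tends to 0 faster than the shift \<open>1 / n\<close> of the right endpoint, so the limit of the
  integrand at \<open>u = b\<close> is \<open>\<pi>\<close> and not \<open>\<pi> / 2\<close>. This yields the right-continuous distribution function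
  at every \<open>b\<close>, atoms included, in a single passage to the limit; the left endpoint meanwhile tends to
  \<open>- \<infinity>\<close>.
\<close>

lemma (in real_distribution) cdf_arctan_limit:
  "(\<lambda>n. \<integral>u. arctan ((b + 1 / real (Suc n) - u) / (1 / (real (Suc n))\<^sup>2))
          - arctan ((b - real (Suc n) - u) / (1 / (real (Suc n))\<^sup>2)) \<partial>M) \<longlonglongrightarrow> pi * cdf M b"
proof -
  have "(\<lambda>n. \<integral>u. arctan ((b + 1 / real (Suc n) - u) / (1 / (real (Suc n))\<^sup>2))
          - arctan ((b - real (Suc n) - u) / (1 / (real (Suc n))\<^sup>2)) \<partial>M)
      \<longlonglongrightarrow> (\<integral>u. pi * indicator {..b} u \<partial>M)"
  proof (rule integral_dominated_convergence[where w = "\<lambda>_. pi"])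
    show "AE u in M. (\<lambda>n. arctan ((b + 1 / real (Suc n) - u) / (1 / (real (Suc n))\<^sup>2))
          - arctan ((b - real (Suc n) - u) / (1 / (real (Suc n))\<^sup>2))) \<longlonglongrightarrow> pi * indicator {..b} u"
    proof (rule AE_I2)
      fix u :: real
      have S: "filterlim (\<lambda>n. real (Suc n)) at_top sequentially"
        by (intro filterlim_compose[OF filterlim_real_sequentially filterlim_Suc])
      have bot: "filterlim (\<lambda>s::real. (b - s - u) / (1 / s\<^sup>2)) at_bot at_top" by real_asymp
      have 1: "((\<lambda>s::real. arctan ((b - s - u) / (1 / s\<^sup>2))) \<longlongrightarrow> - (pi / 2)) at_top"
        by (rule filterlim_compose[OF tendsto_arctan_at_bot bot])
      have 2: "((\<lambda>s::real. arctan ((b + 1 / s - u) / (1 / s\<^sup>2))) \<longlongrightarrow> (if u \<le> b then pi / 2 else - (pi / 2))) at_top"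
      proof (cases "u < b")
        case True
        have "filterlim (\<lambda>s::real. (b + 1 / s - u) / (1 / s\<^sup>2)) at_top at_top" using True by real_asymp
        from filterlim_compose[OF tendsto_arctan_at_top this] True show ?thesis by simp
      next
        case False
        show ?thesis
        proof (cases "u = b")
          case True
          have "filterlim (\<lambda>s::real. (b + 1 / s - b) / (1 / s\<^sup>2)) at_top at_top" by real_asymp
          from filterlim_compose[OF tendsto_arctan_at_top this] True show ?thesis by simp
        next
          case False
          with \<open>\<not> u < b\<close> have ub: "b < u" by simp
          have "filterlim (\<lambda>s::real. (b + 1 / s - u) / (1 / s\<^sup>2)) at_bot at_top" using ub by real_asymp
          from filterlim_compose[OF tendsto_arctan_at_bot this] ub show ?thesis by simp
        qed
      qed
      from tendsto_diff[OF filterlim_compose[OF 2 S] filterlim_compose[OF 1 S]]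
      show "(\<lambda>n. arctan ((b + 1 / real (Suc n) - u) / (1 / (real (Suc n))\<^sup>2))
          - arctan ((b - real (Suc n) - u) / (1 / (real (Suc n))\<^sup>2))) \<longlonglongrightarrow> pi * indicator {..b} u"
        by (auto simp: indicator_def split: if_splits)
    qed
  next
    fix n
    show "AE u in M. norm (arctan ((b + 1 / real (Suc n) - u) / (1 / (real (Suc n))\<^sup>2))
          - arctan ((b - real (Suc n) - u) / (1 / (real (Suc n))\<^sup>2))) \<le> pi"
    proof (rule AE_I2)
      fix u
      show "norm (arctan ((b + 1 / real (Suc n) - u) / (1 / (real (Suc n))\<^sup>2))
          - arctan ((b - real (Suc n) - u) / (1 / (real (Suc n))\<^sup>2))) \<le> pi"
        using arctan_bounded[of "(b + 1 / real (Suc n) - u) / (1 / (real (Suc n))\<^sup>2)"]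
          arctan_bounded[of "(b - real (Suc n) - u) / (1 / (real (Suc n))\<^sup>2)"]
        by (simp only: real_norm_def abs_le_iff) linarith
    qed
  qed auto
  also have "(\<integral>u. pi * indicator {..b} u \<partial>M) = pi * cdf M b"
    by (simp add: cdf_def)
  finally show ?thesis .
qed

text \<open>
  Stieltjes inversion: the smoothed masses determined by the Cauchy transform converge to the distribution
  function.
\<close>

lemma cauchy_transform_inject:
  assumes F: "real_distribution F" and G: "real_distribution G"
    and eq: "\<And>w. 0 < Im w \<Longrightarrow> cauchy_transform F w = cauchy_transform G w"
  shows "F = G"
proof (rule cdf_unique[OF F G], rule ext)
  fix b
  interpret F: real_distribution F by fact
  interpret G: real_distribution G by fact
  have "(\<integral>u. arctan ((d - u) / e) - arctan ((a - u) / e) \<partial>F) = (\<integral>u. arctan ((d - u) / e) - arctan ((a - u) / e) \<partial>G)"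
    if ad: "a \<le> d" "e > 0" for a d e
  proof -
    have ar: "0 \<le> arctan ((d - u) / e) - arctan ((a - u) / e)" for u
      using ad by (simp add: arctan_monotone' divide_right_mono)
    have "ennreal (\<integral>u. arctan ((d - u) / e) - arctan ((a - u) / e) \<partial>F)
        = ennreal (\<integral>u. arctan ((d - u) / e) - arctan ((a - u) / e) \<partial>G)"
      unfolding F.nn_integral_Im_cauchy_transform[OF ad, symmetric]
        G.nn_integral_Im_cauchy_transform[OF ad, symmetric]
      using ad by (simp add: eq)
    then show ?thesis using ar by (subst (asm) ennreal_inj) (auto intro!: integral_nonneg)
  qed
  moreover have "b - real (Suc n) \<le> b + 1 / real (Suc n)" "0 < 1 / (real (Suc n))\<^sup>2" for n
    by (rule order_trans[of _ b]) auto
  ultimately have "(\<lambda>n. \<integral>u. arctan ((b + 1 / real (Suc n) - u) / (1 / (real (Suc n))\<^sup>2))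
          - arctan ((b - real (Suc n) - u) / (1 / (real (Suc n))\<^sup>2)) \<partial>F) =
      (\<lambda>n. \<integral>u. arctan ((b + 1 / real (Suc n) - u) / (1 / (real (Suc n))\<^sup>2))
          - arctan ((b - real (Suc n) - u) / (1 / (real (Suc n))\<^sup>2)) \<partial>G)"
    by (intro ext) blast
  then have "pi * cdf F b = pi * cdf G b"
    using LIMSEQ_unique[OF _ G.cdf_arctan_limit[of b]] F.cdf_arctan_limit[of b] by (simp only:)
  then show "cdf F b = cdf G b" by simp
qed

section \<open>Consequences of bounded product moments\<close>

text \<open>
  If the Cauchy transforms of \<open>F\<close> and of a competitor differed at \<open>w\<close>, then evaluation at \<open>w\<close> would be
  bounded on polynomials of bounded mean square, by \<open>cauchy_transform_diff_bound\<close>.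
\<close>

lemma M_det_distr_if_large_polynomials:
  assumes F: "real_distribution F" "finite_moments F"
    and large: "\<And>w R. 0 < Im w \<Longrightarrow>
      \<exists>p. (\<integral>x. (norm (poly p (complex_of_real x)))\<^sup>2 \<partial>F) \<le> B \<and> R \<le> norm (poly p w)"
  shows "M_det_distr UNIV F"
proof -
  have "G = F" if G: "real_distribution G" "finite_moments G" and m: "same_moments F G" for G
  proof -
    have "cauchy_transform F w = cauchy_transform G w" if w: "0 < Im w" for w
    proof (rule ccontr)
      let ?d = "norm (cauchy_transform F w - cauchy_transform G w)"
      assume "cauchy_transform F w \<noteq> cauchy_transform G w"
      then have d: "0 < ?d" by simp
      obtain p where p: "(\<integral>x. (norm (poly p (complex_of_real x)))\<^sup>2 \<partial>F) \<le> B"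
        "(2 * (1 + B) / Im w + 1) / ?d \<le> norm (poly p w)"
        using large[OF w] by blast
      from p(2) d have "2 * (1 + B) / Im w + 1 \<le> norm (poly p w) * ?d"
        by (simp only: pos_divide_le_eq)
      with cauchy_transform_diff_bound[OF F G m w p(1)] show False by linarith
    qed
    with F G show ?thesis by (intro cauchy_transform_inject) auto
  qed
  with F show ?thesis by (auto simp: M_det_distr_def distribution_on_def)
qed

lemma M_det_distr_restrict:
  assumes "M_det_distr UNIV F" "AE x in F. x \<in> S"
  shows "M_det_distr S F"
  using assms by (auto simp: M_det_distr_def distribution_on_def)

text \<open>
  On the real line the squared modulus of this polynomial is the node product. All its zeros
  \<open>- \<i> * \<nu> k\<close> lie in the lower half-plane, which is why it is large in the upper one.
\<close>

definition node_poly :: "(nat \<Rightarrow> real) \<Rightarrow> nat \<Rightarrow> complex poly" where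
  "node_poly \<nu> N = (\<Prod>k<N. [:1, - (\<i> / complex_of_real (\<nu> k)):])"

lemma poly_node_poly: "poly (node_poly \<nu> N) z = (\<Prod>k<N. 1 - \<i> * z / complex_of_real (\<nu> k))"
  by (simp add: node_poly_def poly_prod mult.commute)

lemma norm_node_factor_sq:
  "(norm (1 - \<i> * z / complex_of_real l))\<^sup>2 = (1 + Im z / l)\<^sup>2 + (Re z / l)\<^sup>2"
  by (simp add: cmod_power2)

lemma norm_node_poly_sq_real:
  "(norm (poly (node_poly \<nu> N) (complex_of_real x)))\<^sup>2 = node_product \<nu> N x"
  unfolding poly_node_poly prod_norm[symmetric] prod_power_distrib norm_node_factor_sq node_product_def
  by simp

lemma norm_node_poly_lower:
  assumes pos: "\<And>k. 0 < \<nu> k" and w: "0 \<le> Im w"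
  shows "1 + Im w * (\<Sum>k<N. 1 / \<nu> k) \<le> norm (poly (node_poly \<nu> N) w)"
proof -
  have "1 + (\<Sum>k<N. Im w / \<nu> k) \<le> (\<Prod>k<N. 1 + Im w / \<nu> k)"
  proof (induction N)
    case (Suc N)
    have nn: "0 \<le> Im w / \<nu> k" for k using w less_imp_le[OF pos] by simp
    have "1 + (\<Sum>k<Suc N. Im w / \<nu> k) \<le> (1 + (\<Sum>k<N. Im w / \<nu> k)) * (1 + Im w / \<nu> N)"
      using mult_nonneg_nonneg[OF sum_nonneg[of "{..<N}" "\<lambda>k. Im w / \<nu> k"] nn[of N]] nn
      by (simp add: algebra_simps)
    also have "\<dots> \<le> (\<Prod>k<N. 1 + Im w / \<nu> k) * (1 + Im w / \<nu> N)"
      using Suc nn[of N] by (intro mult_right_mono) auto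
    finally show ?case by simp
  qed simp
  also have "\<dots> \<le> (\<Prod>k<N. norm (1 - \<i> * w / complex_of_real (\<nu> k)))"
  proof (intro prod_mono conjI)
    fix k
    show "0 \<le> 1 + Im w / \<nu> k" using w less_imp_le[OF pos] by simp
    show "1 + Im w / \<nu> k \<le> norm (1 - \<i> * w / complex_of_real (\<nu> k))"
      using complex_Re_le_cmod[of "1 - \<i> * w / complex_of_real (\<nu> k)"] by simp
  qed
  finally show ?thesis by (simp add: poly_node_poly prod_norm sum_distrib_left)
qed

text \<open>
  In the half-plane of the zeros each squared factor is \<open>1 - 2 Im w / l + \<bar>w\<bar>\<^sup>2 / l\<^sup>2\<close>. Its linear term has the
  favourable sign, so that only the summable squares contribute.
\<close>

lemma norm_node_poly_minus_upper:
  assumes pos: "\<And>k. 0 < \<nu> k" and w: "0 \<le> Im w" and s: "summable (\<lambda>k. 1 / (\<nu> k)\<^sup>2)"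
  shows "(norm (poly (node_poly \<nu> N) (- w)))\<^sup>2 \<le> exp ((norm w)\<^sup>2 * (\<Sum>k. 1 / (\<nu> k)\<^sup>2))"
proof -
  have "(norm (poly (node_poly \<nu> N) (- w)))\<^sup>2 = (\<Prod>k<N. (1 + Im (- w) / \<nu> k)\<^sup>2 + (Re (- w) / \<nu> k)\<^sup>2)"
    unfolding poly_node_poly prod_norm[symmetric] prod_power_distrib norm_node_factor_sq ..
  also have "\<dots> \<le> node_product \<nu> N (norm w)"
    unfolding node_product_def
  proof (intro prod_mono conjI)
    fix k
    have "(1 + Im (- w) / \<nu> k)\<^sup>2 + (Re (- w) / \<nu> k)\<^sup>2 = 1 - 2 * (Im w / \<nu> k) + (norm w / \<nu> k)\<^sup>2"
      by (simp add: power_divide cmod_power2 power2_diff add_divide_distrib)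
    moreover have "0 \<le> Im w / \<nu> k" using w less_imp_le[OF pos] by simp
    ultimately show "(1 + Im (- w) / \<nu> k)\<^sup>2 + (Re (- w) / \<nu> k)\<^sup>2 \<le> 1 + (norm w / \<nu> k)\<^sup>2"
      by linarith
  qed auto
  also have "\<dots> \<le> exp ((norm w)\<^sup>2 * (\<Sum>k. 1 / (\<nu> k)\<^sup>2))" by (rule node_product_le_exp[OF s])
  finally show ?thesis .
qed

lemma sum_unbounded_if_not_summable:
  fixes g :: "nat \<Rightarrow> real"
  assumes "\<And>k. 0 \<le> g k" "\<not> summable g"
  shows "\<exists>N. R \<le> (\<Sum>k<N. g k)"
proof (rule ccontr)
  assume "\<nexists>N. R \<le> (\<Sum>k<N. g k)"
  then have "(\<Sum>k<N. g k) \<le> R" for N by (meson less_imp_le not_le)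
  with assms show False by (meson summableI_nonneg_bounded)
qed

lemma integrable_node_product:
  assumes F: "real_distribution F" "finite_moments F"
  shows "integrable F (node_product \<nu> N)"
  using integrable_Re[OF integrable_complex_poly[OF F, of "node_poly \<nu> N * map_poly cnj (node_poly \<nu> N)"]]
  unfolding norm_poly_sq_eq_poly[symmetric] norm_node_poly_sq_real by simp

lemma M_det_distr_if_node_product_bounded:
  assumes F: "real_distribution F" "finite_moments F"
    and pos: "\<And>k. 0 < \<nu> k" and div: "\<not> summable (\<lambda>k. 1 / \<nu> k)"
    and B: "\<And>N. (\<integral>x. node_product \<nu> N x \<partial>F) \<le> B"
  shows "M_det_distr UNIV F"
proof (rule M_det_distr_if_large_polynomials[OF F])
  fix w :: complex and R :: real
  assume w: "0 < Im w"
  obtain N where "R / Im w \<le> (\<Sum>k<N. 1 / \<nu> k)"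
    using sum_unbounded_if_not_summable[OF _ div] less_imp_le[OF pos] by auto
  then have "R \<le> Im w * (\<Sum>k<N. 1 / \<nu> k)" using w by (simp add: pos_divide_le_eq mult.commute)
  with norm_node_poly_lower[of \<nu> w N] pos w have "R \<le> norm (poly (node_poly \<nu> N) w)" by fastforce
  moreover have "(\<integral>x. (norm (poly (node_poly \<nu> N) (complex_of_real x)))\<^sup>2 \<partial>F) \<le> B"
    unfolding norm_node_poly_sq_real by (rule B)
  ultimately show "\<exists>p. (\<integral>x. (norm (poly p (complex_of_real x)))\<^sup>2 \<partial>F) \<le> B \<and> R \<le> norm (poly p w)"
    by blast
qed

lemma poly_even_odd_parts:
  fixes p :: "'a::comm_ring_1 poly"
  shows "\<exists>e d. \<forall>z. poly p z = poly e (z\<^sup>2) + z * poly d (z\<^sup>2)"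
proof (induction p)
  case 0
  show ?case by (intro exI[of _ 0]) simp
next
  case (pCons a p)
  then obtain e d where "\<And>z. poly p z = poly e (z\<^sup>2) + z * poly d (z\<^sup>2)" by blast
  then have "\<forall>z. poly (pCons a p) z = poly (pCons a d) (z\<^sup>2) + z * poly e (z\<^sup>2)"
    by (simp add: algebra_simps power2_eq_square)
  then show ?case by blast
qed

lemma finite_moments_distr_power2:
  assumes F: "real_distribution F" "finite_moments F"
  shows "finite_moments (distr F borel (\<lambda>x. x\<^sup>2))"
  unfolding finite_moments_def
proof safe
  interpret real_distribution F by fact
  fix n :: nat
  have "integrable F (\<lambda>x. x ^ (2 * n))" by (rule integrable_power_if_finite_moments[OF F])
  then show "integrable (distr F borel (\<lambda>x. x\<^sup>2)) (\<lambda>x. \<bar>x\<bar> ^ n)"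
    by (subst integrable_distr_eq) (auto simp: power_mult power_abs)
qed

lemma finite_moments_distr_abs:
  assumes F: "real_distribution F" "finite_moments F"
  shows "finite_moments (distr F borel (\<lambda>x. \<bar>x\<bar>))"
proof -
  interpret real_distribution F by fact
  show ?thesis using F(2) unfolding finite_moments_def by (simp add: integrable_distr_eq)
qed

text \<open>
  The test polynomials are the even parts of the node polynomials, viewed as polynomials in \<open>u = x\<^sup>2\<close>. They
  are large at \<open>w = v\<^sup>2\<close> because at \<open>v\<close>, in the upper half-plane, the node polynomial is large, and at
  \<open>- v\<close> it is bounded.
\<close>

lemma M_det_distr_power2_if_node_product_bounded:
  assumes F: "real_distribution F" "finite_moments F"
    and pos: "\<And>k. 0 < \<nu> k" and div: "\<not> summable (\<lambda>k. 1 / \<nu> k)"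
    and s: "summable (\<lambda>k. 1 / (\<nu> k)\<^sup>2)"
    and B: "\<And>N. (\<integral>x. node_product \<nu> N x \<partial>F) \<le> B"
  shows "M_det_distr UNIV (distr F borel (\<lambda>x. x\<^sup>2))"
proof (rule M_det_distr_if_large_polynomials)
  interpret real_distribution F by fact
  show "real_distribution (distr F borel (\<lambda>x. x\<^sup>2))" by simp
  show "finite_moments (distr F borel (\<lambda>x. x\<^sup>2))" by (rule finite_moments_distr_power2[OF F])
  fix w :: complex and R :: real
  assume w: "0 < Im w"
  define v where "v = csqrt w"
  have v2: "v\<^sup>2 = w" by (simp add: v_def)
  have Imv: "0 < Im v"
  proof -
    have "Im w = 2 * Re v * Im v" unfolding v2[symmetric] by (simp add: power2_eq_square)
    with w have "0 < 2 * Re v * Im v" by simp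
    moreover have "0 \<le> Re v" using csqrt_principal[of w] by (auto simp: v_def)
    ultimately show ?thesis by (simp add: zero_less_mult_iff)
  qed
  define K where "K = exp ((norm v)\<^sup>2 * (\<Sum>k. 1 / (\<nu> k)\<^sup>2))"
  have K1: "1 \<le> K" using s by (simp add: K_def suminf_nonneg)
  obtain N where "(2 * R + K) / Im v \<le> (\<Sum>k<N. 1 / \<nu> k)"
    using sum_unbounded_if_not_summable[OF _ div] less_imp_le[OF pos] by auto
  then have "2 * R + K \<le> Im v * (\<Sum>k<N. 1 / \<nu> k)" using Imv by (simp add: pos_divide_le_eq mult.commute)
  with norm_node_poly_lower[of \<nu> v N] pos Imv have lower: "2 * R + K \<le> norm (poly (node_poly \<nu> N) v)"
    by fastforce
  have "(norm (poly (node_poly \<nu> N) (- v)))\<^sup>2 \<le> K"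
    unfolding K_def using pos Imv s by (intro norm_node_poly_minus_upper) auto
  also have "K \<le> K\<^sup>2" using K1 by (simp add: power2_eq_square)
  finally have upper: "norm (poly (node_poly \<nu> N) (- v)) \<le> K"
    by (rule power2_le_imp_le) (use K1 in simp)
  obtain e d where ed: "\<And>z. poly (node_poly \<nu> N) z = poly e (z\<^sup>2) + z * poly d (z\<^sup>2)"
    using poly_even_odd_parts by blast
  have e: "2 * poly e (z\<^sup>2) = poly (node_poly \<nu> N) z + poly (node_poly \<nu> N) (- z)" for z
    by (simp add: ed)
  have "2 * norm (poly e w) = norm (poly (node_poly \<nu> N) v + poly (node_poly \<nu> N) (- v))"
    using e[of v] unfolding v2 by (metis norm_mult norm_numeral)
  also have "\<dots> \<ge> norm (poly (node_poly \<nu> N) v) - norm (poly (node_poly \<nu> N) (- v))"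
    by (rule norm_diff_ineq)
  finally have "R \<le> norm (poly e w)" using lower upper by linarith
  moreover have "(\<integral>u. (norm (poly e (complex_of_real u)))\<^sup>2 \<partial>distr F borel (\<lambda>x. x\<^sup>2)) \<le> B"
  proof -
    have le: "(norm (poly e (complex_of_real (x\<^sup>2))))\<^sup>2 \<le> node_product \<nu> N x" for x
    proof -
      let ?q = "\<lambda>x. norm (poly (node_poly \<nu> N) (complex_of_real x))"
      have "(?q (- x))\<^sup>2 = (?q x)\<^sup>2" unfolding norm_node_poly_sq_real by simp
      then have q: "?q (- x) = ?q x" by (simp add: power2_eq_iff_nonneg)
      have "2 * norm (poly e (complex_of_real (x\<^sup>2))) = norm (2 * poly e ((complex_of_real x)\<^sup>2))"
        by (simp add: norm_mult)
      also have "\<dots> \<le> ?q x + ?q (- x)" unfolding e of_real_minus by (rule norm_triangle_ineq)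
      finally have "norm (poly e (complex_of_real (x\<^sup>2))) \<le> ?q x" using q by simp
      then have "(norm (poly e (complex_of_real (x\<^sup>2))))\<^sup>2 \<le> (?q x)\<^sup>2" by (intro power_mono) auto
      then show ?thesis unfolding norm_node_poly_sq_real .
    qed
    have meas: "(\<lambda>u. poly e (complex_of_real u)) \<in> borel_measurable borel"
      by (intro borel_measurable_continuous_onI continuous_intros)
    have "(\<integral>u. (norm (poly e (complex_of_real u)))\<^sup>2 \<partial>distr F borel (\<lambda>x. x\<^sup>2))
        = (\<integral>x. (norm (poly e (complex_of_real (x\<^sup>2))))\<^sup>2 \<partial>F)"
      using meas by (intro integral_distr) auto
    also have "\<dots> \<le> (\<integral>x. node_product \<nu> N x \<partial>F)"
      using le by (intro integral_mono_AE' integrable_node_product F)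
        (auto intro: order_trans[OF zero_le_one node_product_ge_1])
    also have "\<dots> \<le> B" by (rule B)
    finally show ?thesis .
  qed
  ultimately show "\<exists>p. (\<integral>x. (norm (poly p (complex_of_real x)))\<^sup>2 \<partial>distr F borel (\<lambda>x. x\<^sup>2)) \<le> B
      \<and> R \<le> norm (poly p w)" by blast
qed

lemma M_det_distr_abs_if_node_product_bounded:
  assumes F: "real_distribution F" "finite_moments F"
    and pos: "\<And>k. 0 < \<nu> k" and div: "\<not> summable (\<lambda>k. 1 / \<nu> k)"
    and B: "\<And>N. (\<integral>x. node_product \<nu> N x \<partial>F) \<le> B"
  shows "M_det_distr UNIV (distr F borel (\<lambda>x. \<bar>x\<bar>))"
proof -
  interpret real_distribution F by fact
  show ?thesis
  proof (rule M_det_distr_if_node_product_bounded[OF _ finite_moments_distr_abs[OF F] pos div])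
    show "real_distribution (distr F borel (\<lambda>x. \<bar>x\<bar>))" by simp
    show "(\<integral>x. node_product \<nu> N x \<partial>distr F borel (\<lambda>x. \<bar>x\<bar>)) \<le> B" for N
      using B[of N] by (subst integral_distr) auto
  qed
qed

lemma even_power_le_node_product:
  assumes pos: "\<And>k. 0 < \<nu> k" and mono: "\<And>i j. i \<le> j \<Longrightarrow> \<nu> i \<le> \<nu> j"
  shows "x ^ (2 * n) \<le> (\<nu> n) ^ (2 * n) * node_product \<nu> n x"
proof -
  have "x ^ (2 * n) = (\<Prod>k<n. x\<^sup>2)" by (simp add: power_mult)
  also have "\<dots> \<le> (\<Prod>k<n. (\<nu> n)\<^sup>2 * (1 + (x / \<nu> k)\<^sup>2))"
  proof (intro prod_mono conjI)
    fix k assume "k \<in> {..<n}"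
    then have "\<nu> k \<le> \<nu> n" by (intro mono) auto
    then have "\<nu> k * \<bar>x / \<nu> k\<bar> \<le> \<nu> n * \<bar>x / \<nu> k\<bar>" by (intro mult_right_mono) auto
    then have "\<bar>x\<bar> \<le> \<nu> n * \<bar>x / \<nu> k\<bar>" using pos[of k] by simp
    then have "\<bar>x\<bar>\<^sup>2 \<le> (\<nu> n * \<bar>x / \<nu> k\<bar>)\<^sup>2" by (intro power_mono) auto
    then have "x\<^sup>2 \<le> (\<nu> n)\<^sup>2 * (x / \<nu> k)\<^sup>2"
      by (simp only: power_mult_distrib power2_abs)
    then show "x\<^sup>2 \<le> (\<nu> n)\<^sup>2 * (1 + (x / \<nu> k)\<^sup>2)"
      unfolding distrib_left by (intro add_increasing) auto
  qed auto
  also have "\<dots> = (\<nu> n) ^ (2 * n) * node_product \<nu> n x"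
    by (simp add: prod.distrib node_product_def power_mult)
  finally show ?thesis .
qed

text \<open>
  Bounding the product moments by \<open>B\<close> bounds the moment of order \<open>2 n\<close> by \<open>B (\<nu> n) ^ (2 n)\<close>, so the terms of
  Carleman's series dominate a multiple of \<open>1 / \<nu> n\<close>. The even moments have to be positive because
  \<open>0 powr a\<close> is 0, not \<open>\<infinity>\<close>.
\<close>

lemma carleman_if_node_product_bounded:
  assumes F: "real_distribution F" "finite_moments F"
    and pos: "\<And>k. 0 < \<nu> k" and mono: "\<And>i j. i \<le> j \<Longrightarrow> \<nu> i \<le> \<nu> j"
    and div: "\<not> summable (\<lambda>k. 1 / \<nu> k)"
    and B: "\<And>N. (\<integral>x. node_product \<nu> N x \<partial>F) \<le> B"
    and m0: "\<And>n. 0 < (\<integral>x. x ^ (2 * n) \<partial>F)"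
  shows "carleman_condition F (\<lambda>x. x)"
proof (rule ccontr)
  assume "\<not> carleman_condition F (\<lambda>x. x)"
  then have sm: "summable (\<lambda>n. (\<integral>x. x ^ (2 * Suc n) \<partial>F) powr (- 1 / real (2 * Suc n)))"
    unfolding carleman_condition_def by (intro summable_suminf_not_top) auto
  \<comment> \<open>Enlarging \<open>B\<close> to \<open>b \<ge> 1\<close> gives \<open>B \<le> b ^ (2 n)\<close>, so that the constant leaves the root as the factor \<open>b\<close>.\<close>
  define b where "b = max 1 B"
  have b: "1 \<le> b" "B \<le> b" by (auto simp: b_def)
  have "summable (\<lambda>n. 1 / (b * \<nu> (Suc n)))"
  proof (rule summable_comparison_test'[OF sm])
    fix n
    let ?k = "2 * Suc n"
    let ?c = "b * \<nu> (Suc n)"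
    have c: "0 < ?c" using b pos by auto
    have "(\<integral>x. x ^ ?k \<partial>F) \<le> (\<integral>x. (\<nu> (Suc n)) ^ ?k * node_product \<nu> (Suc n) x \<partial>F)"
      by (intro integral_mono integrable_power_if_finite_moments integrable_mult_right
          integrable_node_product F even_power_le_node_product pos mono)
    also have "\<dots> = (\<nu> (Suc n)) ^ ?k * (\<integral>x. node_product \<nu> (Suc n) x \<partial>F)" by simp
    also have "\<dots> \<le> (\<nu> (Suc n)) ^ ?k * b ^ ?k"
    proof (rule mult_left_mono)
      have "b \<le> b ^ ?k" using b by (intro self_le_power) auto
      then show "(\<integral>x. node_product \<nu> (Suc n) x \<partial>F) \<le> b ^ ?k" using B[of "Suc n"] b(2) by linarith
    qed (use pos[of "Suc n"] in auto)
    also have "\<dots> = ?c ^ ?k" by (simp only: power_mult_distrib mult.commute)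
    finally have "(?c ^ ?k) powr (- 1 / real ?k) \<le> (\<integral>x. x ^ ?k \<partial>F) powr (- 1 / real ?k)"
      using m0[of "Suc n"] by (intro powr_mono2') auto
    moreover have "(?c ^ ?k) powr (- 1 / real ?k) = 1 / ?c"
    proof -
      have "(?c ^ ?k) powr (- 1 / real ?k) = (?c powr real ?k) powr (- 1 / real ?k)"
        using c by (simp only: powr_realpow)
      also have "\<dots> = ?c powr (-1)" unfolding powr_powr by simp
      finally show ?thesis using c by (simp add: powr_minus_divide)
    qed
    ultimately show "norm (1 / ?c) \<le> (\<integral>x. x ^ ?k \<partial>F) powr (- 1 / real ?k)" using c by simp
  qed
  then have "summable (\<lambda>n. b * (1 / (b * \<nu> (Suc n))))" by (rule summable_mult)
  then have "summable (\<lambda>n. 1 / \<nu> (Suc n))" using b by simp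
  with div show False by (simp add: summable_Suc_iff[of "\<lambda>k. 1 / \<nu> k"])
qed

section \<open>The tail estimate\<close>

text \<open>
  Change of variables shows \<open>integral {y1..} h \<le> s * integral {x1..} h\<close>. The right-hand side is finite, so it
  can be absorbed into \<open>integral {x1..} h = integral {x1..y1} h + integral {y1..} h\<close>.
\<close>

lemma integral_le_if_shift_contracts:
  fixes h \<psi> d :: "real \<Rightarrow> real"
  assumes xy: "x1 \<le> y1" and h: "h absolutely_integrable_on {x1..}" and h0: "\<And>x. x1 \<le> x \<Longrightarrow> 0 \<le> h x"
    and img: "\<psi> ` {y1..} = {x1..}" and inj: "inj_on \<psi> {y1..}"
    and der: "\<And>y. y1 \<le> y \<Longrightarrow> (\<psi> has_real_derivative d y) (at y within {y1..})"
    and contr: "\<And>y. y1 \<le> y \<Longrightarrow> h y \<le> s * (\<bar>d y\<bar> * h (\<psi> y))" and s: "s < 1"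
  shows "integral {x1..} h \<le> integral {x1..y1} h / (1 - s)"
proof -
  let ?g = "\<lambda>y. \<bar>d y\<bar> * h (\<psi> y)"
  have "?g absolutely_integrable_on {y1..} \<and> integral {y1..} ?g = integral {x1..} h"
    using has_absolute_integral_change_of_variables_1'[of "{y1..}" \<psi> d h "integral {x1..} h"] der inj h
    unfolding img by auto
  then have g: "?g integrable_on {y1..}" "integral {y1..} ?g = integral {x1..} h"
    by (auto intro: set_lebesgue_integral_eq_integral)
  have hy: "h absolutely_integrable_on {y1..}" "h absolutely_integrable_on {x1..y1}"
    using xy by (auto intro: set_integrable_subset[OF h])
  then have hy': "h integrable_on {y1..}" "h integrable_on {x1..y1}"
    by (auto intro: set_lebesgue_integral_eq_integral)
  have "integral {y1..} h \<le> integral {y1..} (\<lambda>y. s * ?g y)"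
    using contr hy' integrable_on_cmult_left[OF g(1), of s] by (intro integral_le) auto
  also have "\<dots> = s * integral {x1..} h" by (simp only: integral_mult_right g)
  finally have "integral {y1..} h \<le> s * integral {x1..} h" .
  moreover have "integral {x1..} h = integral {x1..y1} h + integral {y1..} h"
  proof -
    have "{x1..} = {x1..y1} \<union> {y1..}" "{x1..y1} \<inter> {y1..} = {y1}" using xy by auto
    then show ?thesis using integral_Un[OF hy'(2) hy'(1)] by simp
  qed
  ultimately have "integral {x1..} h * (1 - s) \<le> integral {x1..y1} h" by (simp add: algebra_simps)
  then show ?thesis using s by (simp add: pos_le_divide_eq)
qed

lemma outer_part_borel [measurable]: "outer_part x0 \<in> sets borel"
  by (simp add: outer_part_def)

text \<open>
  The density describes \<open>F\<close> on subsets of \<open>S\<close> only, so \<open>F\<close> is restricted to \<open>A\<close> by the density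
  \<open>indicator A\<close> before the two measures are compared.
\<close>

lemma density_on_integral:
  assumes F: "real_distribution F" and dens: "has_density_on F f S" and pos: "\<forall>x\<in>S. 0 < f x"
    and S: "S \<in> sets borel" and A: "A \<in> sets borel" "A \<subseteq> S" and g: "integrable F g" "g \<in> borel_measurable borel"
  shows "(\<lambda>x. g x * f x) absolutely_integrable_on A"
    and "(\<integral>x. indicator A x * g x \<partial>F) = integral A (\<lambda>x. g x * f x)"
proof -
  interpret real_distribution F by fact
  note [measurable] = S A(1) g(2)
  define fA where "fA x = indicator A x * f x" for x
  have "(\<lambda>x. indicator S x *\<^sub>R f x) \<in> borel_measurable borel"
    using dens by (simp add: has_density_on_def set_borel_measurable_def)
  then have "(\<lambda>x. indicator A x * (indicator S x *\<^sub>R f x)) \<in> borel_measurable borel"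
    by measurable
  moreover have "indicator A x * (indicator S x *\<^sub>R f x) = fA x" for x
    using A(2) by (auto simp: fA_def indicator_def)
  ultimately have fm [measurable]: "fA \<in> borel_measurable borel" by simp
  have f0: "0 \<le> fA x" for x using pos A(2) by (auto simp: fA_def indicator_def less_imp_le)
  have eq: "density F (\<lambda>x. ennreal (indicator A x)) = density lborel (\<lambda>x. ennreal (fA x))"
  proof (rule measure_eqI)
    fix T assume "T \<in> sets (density F (\<lambda>x. ennreal (indicator A x)))"
    then have T [measurable]: "T \<in> sets borel" by simp
    have "emeasure (density F (\<lambda>x. ennreal (indicator A x))) T = emeasure F (A \<inter> T)"
      by (simp add: emeasure_density ennreal_indicator indicator_inter_arith[symmetric])
    also have "\<dots> = (\<integral>\<^sup>+x\<in>A \<inter> T. ennreal (f x) \<partial>lborel)"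
    proof -
      have "A \<inter> T \<in> sets borel" "A \<inter> T \<subseteq> S" using A by auto
      then show ?thesis using dens unfolding has_density_on_def by blast
    qed
    also have "\<dots> = (\<integral>\<^sup>+x. ennreal (fA x) * indicator T x \<partial>lborel)"
      by (intro nn_integral_cong) (auto simp: fA_def indicator_def)
    also have "\<dots> = emeasure (density lborel (\<lambda>x. ennreal (fA x))) T"
      by (simp add: emeasure_density)
    finally show "emeasure (density F (\<lambda>x. ennreal (indicator A x))) T
        = emeasure (density lborel (\<lambda>x. ennreal (fA x))) T" .
  qed simp
  have fg: "fA x * g x = indicator A x *\<^sub>R (g x * f x)" for x by (simp add: fA_def)
  have "integrable F (\<lambda>x. indicator A x *\<^sub>R g x)"
    using g(1) by (intro integrable_mult_indicator) auto
  then have "integrable (density F (\<lambda>x. ennreal (indicator A x))) g"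
    by (subst integrable_density) auto
  then have i: "integrable lborel (\<lambda>x. fA x *\<^sub>R g x)"
    unfolding eq by (subst (asm) integrable_density) (use f0 in auto)
  then have si: "set_integrable lborel A (\<lambda>x. g x * f x)"
    by (simp add: set_integrable_def fg)
  have "(\<lambda>x. fA x *\<^sub>R g x) \<in> borel_measurable lborel" by measurable
  then show "(\<lambda>x. g x * f x) absolutely_integrable_on A"
    using i unfolding set_integrable_def by (simp add: integrable_completion fg)
  have "(\<integral>x. indicator A x * g x \<partial>F) = (\<integral>x. g x \<partial>density F (\<lambda>x. ennreal (indicator A x)))"
    by (subst integral_density) auto
  also have "\<dots> = (\<integral>x. fA x *\<^sub>R g x \<partial>lborel)"
    unfolding eq by (subst integral_density) (use f0 in auto)
  also have "\<dots> = (LINT x:A|lborel. g x * f x)" by (simp add: set_lebesgue_integral_def fg)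
  also have "\<dots> = integral A (\<lambda>x. g x * f x)" by (rule set_borel_integral_eq_integral(2)[OF si])
  finally show "(\<integral>x. indicator A x * g x \<partial>F) = integral A (\<lambda>x. g x * f x)" .
qed

text \<open>
  Here \<open>\<psi>\<close> is the inverse \<open>x(y)\<close> of the shift map and \<open>d\<close> its derivative. Surjectivity onto the half-line
  comes from the intermediate value theorem, as \<open>shift_map \<phi> x \<ge> x\<close>.
\<close>

lemma shift_inverse_exists:
  assumes "shift_assumption x0 \<phi>"
  obtains C Y and \<psi> d :: "real \<Rightarrow> real" where "0 < C"
    and "\<And>y. Y \<le> y \<Longrightarrow> x0 \<le> \<psi> y"
    and "\<And>y. Y \<le> y \<Longrightarrow> shift_map \<phi> (\<psi> y) = y"
    and "\<And>y. Y \<le> y \<Longrightarrow> y - \<psi> y \<le> C * ln y"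
    and "\<And>y. Y \<le> y \<Longrightarrow> (\<psi> has_real_derivative d y) (at y within {Y..})"
    and "\<And>y. Y \<le> y \<Longrightarrow> y * (1 - d y) \<le> C"
    and "\<And>y. Y \<le> y \<Longrightarrow> \<psi> ` {y..} = {\<psi> y..}"
proof -
  define \<psi> where "\<psi> = the_inv_into {x0..} (shift_map \<phi>)"
  let ?y0 = "shift_map \<phi> x0"
  have x0: "0 < x0" and \<phi>0: "\<And>x. x0 \<le> x \<Longrightarrow> 0 \<le> \<phi> x" and dif: "\<phi> differentiable_on {x0..}"
    and sm: "strict_mono_on {x0..} (shift_map \<phi>)"
    using assms by (auto simp: shift_assumption_def)
  obtain C Y where C: "0 < C" and Y: "?y0 \<le> Y"
    and bs: "\<And>y. Y \<le> y \<Longrightarrow> back_shift x0 \<phi> y \<le> C * ln y \<and>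
        (\<exists>d. (back_shift x0 \<phi> has_real_derivative d) (at y within {?y0..}) \<and> d \<in> {0..1} \<and> y * d \<le> C)"
    using assms unfolding shift_assumption_def by blast
  obtain d where d: "\<And>y. Y \<le> y \<Longrightarrow> (back_shift x0 \<phi> has_real_derivative d y) (at y within {?y0..}) \<and> y * d y \<le> C"
    using bs by metis
  have inj: "inj_on (shift_map \<phi>) {x0..}" using sm by (rule strict_mono_on_imp_inj_on)
  have cont: "continuous_on {x0..} (shift_map \<phi>)"
    unfolding shift_map_def[abs_def]
    by (intro continuous_intros differentiable_imp_continuous_on dif)
  have range: "y \<in> shift_map \<phi> ` {x0..}" if y: "?y0 \<le> y" for y
  proof -
    have "x0 \<le> y" using y \<phi>0[of x0] by (simp add: shift_map_def)
    moreover from this have "y \<le> shift_map \<phi> y" using \<phi>0 by (simp add: shift_map_def)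
    ultimately obtain x where "x0 \<le> x" "shift_map \<phi> x = y"
      using IVT'[of "shift_map \<phi>" x0 y y] y continuous_on_subset[OF cont, of "{x0..y}"] by auto
    then show ?thesis by auto
  qed
  have \<psi>: "x0 \<le> \<psi> y" "shift_map \<phi> (\<psi> y) = y" if "Y \<le> y" for y
  proof -
    have r: "y \<in> shift_map \<phi> ` {x0..}" using range that Y by simp
    show "shift_map \<phi> (\<psi> y) = y" unfolding \<psi>_def by (rule f_the_inv_into_f[OF inj r])
    show "x0 \<le> \<psi> y" using the_inv_into_into[OF inj r order_refl] by (simp add: \<psi>_def)
  qed
  have bs_\<psi>: "back_shift x0 \<phi> y = y - \<psi> y" for y by (simp add: back_shift_def \<psi>_def)
  show thesis
  proof (rule that[of C Y \<psi> "\<lambda>y. 1 - d y"])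
    fix y assume y: "Y \<le> y"
    show "(\<psi> has_real_derivative 1 - d y) (at y within {Y..})"
    proof -
      have "(back_shift x0 \<phi> has_real_derivative d y) (at y within {Y..})"
        using d[OF y] Y by (auto intro: has_field_derivative_subset)
      then have "((\<lambda>t. t - back_shift x0 \<phi> t) has_real_derivative 1 - d y) (at y within {Y..})"
        by (intro derivative_intros)
      then show ?thesis by (simp add: bs_\<psi>)
    qed
    show "y * (1 - (1 - d y)) \<le> C" using d[OF y] by simp
    show "y - \<psi> y \<le> C * ln y" using bs[OF y] by (simp add: bs_\<psi>)
    show "\<psi> ` {y..} = {\<psi> y..}"
    proof safe
      fix t assume t: "y \<le> t"
      show "\<psi> y \<le> \<psi> t"
      proof (rule ccontr)
        assume "\<not> \<psi> y \<le> \<psi> t"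
        then have "shift_map \<phi> (\<psi> t) < shift_map \<phi> (\<psi> y)"
          using \<psi>(1) t y by (intro strict_mono_onD[OF sm]) auto
        then show False using \<psi>(2)[of t] \<psi>(2)[of y] t y by simp
      qed
    next
      fix x assume x: "\<psi> y \<le> x"
      have "\<psi> (shift_map \<phi> x) = x"
        unfolding \<psi>_def using \<psi>(1)[OF y] x by (intro the_inv_into_f_f[OF inj]) auto
      moreover have "y \<le> shift_map \<phi> x"
        using strict_mono_on_leD[OF sm, of "\<psi> y" x] \<psi>[OF y] x by simp
      ultimately show "x \<in> \<psi> ` {y..}" by (intro image_eqI[of _ _ "shift_map \<phi> x"]) auto
    qed
  qed (use C \<psi> in auto)
qed

lemma summable_inverse_square_scaled_log_node: "summable (\<lambda>k. 1 / (A * log_node k)\<^sup>2)"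
  using summable_mult[OF summable_inverse_square_log_node, of "1 / A\<^sup>2"]
  by (simp add: power_mult_distrib)

text \<open>
  Going from \<open>x = \<psi> y\<close> to \<open>y\<close>, the density loses the factor \<open>q\<close>, the node product gains at most
  \<open>exp (192 C / A)\<close>, and \<open>dy = dx / d y\<close> with \<open>d y \<ge> 1 - C / y\<close>. For large \<open>A\<close> and \<open>y\<close> the total factor
  stays below 1. The threshold \<open>A0\<close> comes before \<open>x1\<close> and \<open>B\<close>, which depend on \<open>A\<close>, so that one \<open>A\<close> can serve
  both tails of a distribution.
\<close>

lemma node_product_tail_bounded:
  assumes shift: "shift_assumption x0 \<phi>"
    and F: "real_distribution F" "finite_moments F"
    and dens: "has_density_on F f (outer_part x0)" and pos: "\<forall>x\<in>outer_part x0. 0 < f x"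
    and q: "0 < q" "q < 1" and ratio: "\<And>x. b \<le> x \<Longrightarrow> x0 \<le> x \<Longrightarrow> f (x + \<phi> x) \<le> q * f x"
  shows "\<exists>A0. \<forall>A\<ge>A0. \<exists>x1 B. \<forall>N.
    (\<integral>x. indicator {x1..} x * node_product (\<lambda>k. A * log_node k) N x \<partial>F) \<le> B"
proof -
  interpret real_distribution F by fact
  have x0: "0 < x0" and \<phi>0: "\<And>x. x0 \<le> x \<Longrightarrow> 0 \<le> \<phi> x"
    using shift by (auto simp: shift_assumption_def)
  obtain C Y \<psi> d where C: "0 < C"
    and \<psi>0: "\<And>y. Y \<le> y \<Longrightarrow> x0 \<le> \<psi> y"
    and \<psi>: "\<And>y. Y \<le> y \<Longrightarrow> shift_map \<phi> (\<psi> y) = y"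
    and \<psi>ln: "\<And>y. Y \<le> y \<Longrightarrow> y - \<psi> y \<le> C * ln y"
    and der: "\<And>y. Y \<le> y \<Longrightarrow> (\<psi> has_real_derivative d y) (at y within {Y..})"
    and dC: "\<And>y. Y \<le> y \<Longrightarrow> y * (1 - d y) \<le> C"
    and img: "\<And>y. Y \<le> y \<Longrightarrow> \<psi> ` {y..} = {\<psi> y..}"
  proof (rule shift_inverse_exists[OF shift], goal_cases)
    case (1 C Y \<psi> d)
    show ?case by (rule 1(1)) (fact 1(2-))+
  qed
  \<comment> \<open>The gap between \<open>q\<close> and 1 is shared out equally: with \<open>q = s\<^sup>3\<close>, one factor \<open>1 / s\<close> is granted to the growth
     of the node product, one to the change of variables, and the factor \<open>s\<close> is left for the contraction.\<close>
  define s where "s = root 3 q"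
  have s3: "q = s * s * s" using odd_real_root_pow[of 3 q] by (simp add: s_def power3_eq_cube)
  have s: "0 < s" "s < 1" using q by (auto simp: s_def)
  have ls: "ln s < 0" using s by simp
  show ?thesis
  proof (rule exI[of _ "max 2 (192 * C / (- ln s))"], intro allI impI)
    fix A assume "max 2 (192 * C / (- ln s)) \<le> A"
    then have A: "2 \<le> A" "192 * C / (- ln s) \<le> A" by auto
    define \<nu> where "\<nu> = (\<lambda>k. A * log_node k)"
    have expA: "exp (192 * C / A) \<le> 1 / s"
    proof -
      have "192 * C \<le> A * (- ln s)" using A(2) ls by (simp only: pos_divide_le_eq)
      then have "192 * C / A \<le> - ln s" using A(1) by (simp add: pos_divide_le_eq mult.commute)
      then have "exp (192 * C / A) \<le> exp (- ln s)" by simp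
      then show ?thesis using s by (simp add: exp_minus divide_inverse)
    qed
    \<comment> \<open>Beyond \<open>y1\<close> the preimage satisfies \<open>\<psi> y \<ge> y / 2\<close>, hence \<open>\<psi> y \<ge> A\<^sup>2\<close> and \<open>\<psi> y \<ge> b\<close>, and \<open>d y \<ge> s\<close>.\<close>
    have "eventually (\<lambda>y. C * ln y \<le> y / 2) at_top" using C by real_asymp
    moreover have "eventually (\<lambda>y. C \<le> y * (1 - s)) at_top" using s by real_asymp
    ultimately have "eventually (\<lambda>y. C * ln y \<le> y / 2 \<and> C \<le> y * (1 - s) \<and> Y \<le> y \<and> 1 \<le> y \<and> A\<^sup>2 \<le> y / 2 \<and> b \<le> y / 2) at_top"
      using eventually_ge_at_top[of "max (max Y 1) (max (2 * A\<^sup>2) (2 * b))"] by eventually_elim auto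
    then obtain y1 where y1: "\<And>y. y1 \<le> y \<Longrightarrow> C * ln y \<le> y / 2 \<and> C \<le> y * (1 - s) \<and> Y \<le> y \<and> 1 \<le> y \<and> A\<^sup>2 \<le> y / 2 \<and> b \<le> y / 2"
      unfolding eventually_at_top_linorder by blast
    define x1 where "x1 = \<psi> y1"
    have le: "\<psi> y \<le> y" if "y1 \<le> y" for y
      using \<phi>0[of "\<psi> y"] \<psi>0[of y] \<psi>[of y] y1[OF that] by (simp add: shift_map_def)
    have x1: "x0 \<le> x1" "x1 \<le> y1" using \<psi>0 y1[of y1] le by (auto simp: x1_def)
    have sub: "{x1..} \<subseteq> outer_part x0" "{x1..y1} \<subseteq> outer_part x0" using x1 by (auto simp: outer_part_def)
    have f0: "0 < f x" if "x0 \<le> x" for x using pos that by (auto simp: outer_part_def)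
    have "(\<integral>x. indicator {x1..} x * node_product \<nu> N x \<partial>F)
        \<le> exp (y1\<^sup>2 * (\<Sum>k. 1 / (\<nu> k)\<^sup>2)) / (1 - s)" for N
    proof -
      let ?W = "node_product \<nu> N"
      have W0: "0 \<le> ?W x" for x by (rule order_trans[OF zero_le_one node_product_ge_1])
      have W: "integrable F ?W" "?W \<in> borel_measurable borel" using integrable_node_product[OF F] by auto
      have "integral {x1..} (\<lambda>x. ?W x * f x) \<le> integral {x1..y1} (\<lambda>x. ?W x * f x) / (1 - s)"
      proof (rule integral_le_if_shift_contracts[where \<psi> = \<psi> and d = d])
        show "(\<lambda>x. ?W x * f x) absolutely_integrable_on {x1..}"
          by (rule density_on_integral[OF F(1) dens pos _ _ sub(1) W]) auto
        show "0 \<le> ?W x * f x" if "x1 \<le> x" for x using W0 f0[of x] x1 that by simp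
        show "\<psi> ` {y1..} = {x1..}" unfolding x1_def using y1[of y1] by (intro img) auto
        show "inj_on \<psi> {y1..}" by (rule inj_on_inverseI[where g = "shift_map \<phi>"]) (use \<psi> y1 in auto)
        show "(\<psi> has_real_derivative d y) (at y within {y1..})" if "y1 \<le> y" for y
          using der[of y] y1[OF that] y1[of y1] by (auto intro: has_field_derivative_subset)
        fix y assume y: "y1 \<le> y"
        note Y = y1[OF y]
        let ?x = "\<psi> y"
        have x: "x0 \<le> ?x" "y / 2 \<le> ?x" using \<psi>0 \<psi>ln[of y] Y by auto
        have "?W y \<le> exp (192 * C / A) * ?W ?x"
          unfolding \<nu>_def using A Y x le[OF y] C \<psi>ln[of y]
          by (intro node_product_log_node_growth) auto
        also have "\<dots> \<le> 1 / s * ?W ?x" by (rule mult_right_mono[OF expA W0])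
        finally have Wy: "?W y \<le> 1 / s * ?W ?x" .
        have fy: "f y \<le> q * f ?x"
          using ratio[of ?x] x Y \<psi>[of y] by (simp add: shift_map_def)
        have "s \<le> d y"
        proof -
          have "y * (1 - d y) \<le> y * (1 - s)" using dC[of y] Y by linarith
          then show ?thesis using Y by (simp add: mult_le_cancel_left)
        qed
        then have sd: "s * (?W ?x * f ?x) \<le> \<bar>d y\<bar> * (?W ?x * f ?x)"
          using W0 f0[OF x(1)] by (intro mult_right_mono) auto
        have "?W y * f y \<le> (1 / s * ?W ?x) * (q * f ?x)"
          using W0 Wy fy f0[of y] x le[OF y] s by (intro mult_mono) auto
        also have "\<dots> = s * (s * (?W ?x * f ?x))" using s by (simp add: s3)
        also have "\<dots> \<le> s * (\<bar>d y\<bar> * (?W ?x * f ?x))" using s sd by (intro mult_left_mono) auto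
        finally show "?W y * f y \<le> s * (\<bar>d y\<bar> * (?W ?x * f ?x))" .
      qed (use x1 s in auto)
      also have "integral {x1..y1} (\<lambda>x. ?W x * f x) = (\<integral>x. indicator {x1..y1} x * ?W x \<partial>F)"
        by (rule density_on_integral(2)[OF F(1) dens pos _ _ sub(2) W, symmetric]) auto
      also have "(\<integral>x. indicator {x1..y1} x * ?W x \<partial>F) \<le> (\<integral>x. exp (y1\<^sup>2 * (\<Sum>k. 1 / (\<nu> k)\<^sup>2)) \<partial>F)"
      proof (rule integral_mono)
        show "integrable F (\<lambda>x. indicator {x1..y1} x * ?W x)"
          using integrable_mult_indicator[OF _ W(1), of "{x1..y1}"] by simp
        fix x
        have "?W y1 \<le> exp (y1\<^sup>2 * (\<Sum>k. 1 / (\<nu> k)\<^sup>2))"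
          unfolding \<nu>_def by (rule node_product_le_exp[OF summable_inverse_square_scaled_log_node])
        moreover have "?W x \<le> ?W y1" if "x \<in> {x1..y1}" using that x0 x1 by (intro node_product_mono) auto
        ultimately show "indicator {x1..y1} x * ?W x \<le> exp (y1\<^sup>2 * (\<Sum>k. 1 / (\<nu> k)\<^sup>2))"
          by (auto simp: indicator_def)
      qed simp
      also have "\<dots> = exp (y1\<^sup>2 * (\<Sum>k. 1 / (\<nu> k)\<^sup>2))" using prob_space by simp
      also have "integral {x1..} (\<lambda>x. ?W x * f x) = (\<integral>x. indicator {x1..} x * ?W x \<partial>F)"
        by (rule density_on_integral(2)[OF F(1) dens pos _ _ sub(1) W, symmetric]) auto
      finally show ?thesis using s by (simp add: divide_right_mono)
    qed
    then show "\<exists>x1 B. \<forall>N. (\<integral>x. indicator {x1..} x * node_product (\<lambda>k. A * log_node k) N x \<partial>F) \<le> B"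
      unfolding \<nu>_def by blast
  qed
qed

lemma has_density_on_uminus:
  assumes F: "real_distribution F" and dens: "has_density_on F f (outer_part x0)"
  shows "has_density_on (distr F borel uminus) (\<lambda>x. f (- x)) (outer_part x0)"
proof -
  interpret real_distribution F by fact
  let ?S = "outer_part x0"
  have sym: "indicator ?S (- x) = indicator ?S x" for x :: real
    by (auto simp: outer_part_def indicator_def)
  have fm [measurable]: "(\<lambda>x. indicator ?S x *\<^sub>R f x) \<in> borel_measurable borel"
    using dens by (simp add: has_density_on_def set_borel_measurable_def)
  have "(\<lambda>x. indicator ?S (- x) *\<^sub>R f (- x)) \<in> borel_measurable borel" by measurable
  then have "set_borel_measurable borel ?S (\<lambda>x. f (- x))"
    by (simp add: set_borel_measurable_def sym)
  moreover have "emeasure (distr F borel uminus) A = (\<integral>\<^sup>+x\<in>A. ennreal (f (- x)) \<partial>lborel)"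
    if A [measurable]: "A \<in> sets borel" and AS: "A \<subseteq> ?S" for A
  proof -
    have v [measurable]: "uminus -` A \<in> sets borel" using measurable_sets_borel[OF _ A, of uminus] by simp
    have vS: "uminus -` A \<subseteq> ?S" using AS by (force simp: outer_part_def)
    have "emeasure (distr F borel uminus) A = emeasure F (uminus -` A)"
      by (simp add: emeasure_distr)
    also have "\<dots> = (\<integral>\<^sup>+x. ennreal (f x) * indicator (uminus -` A) x \<partial>lborel)"
      using dens v vS by (simp add: has_density_on_def)
    also have "\<dots> = (\<integral>\<^sup>+x. ennreal (indicator ?S x *\<^sub>R f x) * indicator (uminus -` A) x \<partial>lborel)"
      using vS by (intro nn_integral_cong) (auto simp: indicator_def)
    also have "\<dots> = (\<integral>\<^sup>+x. ennreal (indicator ?S x *\<^sub>R f x) * indicator (uminus -` A) x \<partial>distr lborel borel uminus)"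
      by (simp add: lborel_distr_uminus)
    also have "\<dots> = (\<integral>\<^sup>+x. ennreal (indicator ?S (- x) *\<^sub>R f (- x)) * indicator (uminus -` A) (- x) \<partial>lborel)"
      by (rule nn_integral_distr) measurable
    also have "\<dots> = (\<integral>\<^sup>+x\<in>A. ennreal (f (- x)) \<partial>lborel)"
      using AS by (intro nn_integral_cong) (auto simp: indicator_def outer_part_def)
    finally show ?thesis .
  qed
  ultimately show ?thesis by (auto simp: has_density_on_def)
qed

section \<open>Carleman condition and determinacy for a rapidly decreasing density\<close>

text \<open>
  The tail estimate is applied to \<open>F\<close> and to its reflection, with a common \<open>A\<close>; in between, node products are
  bounded because \<open>\<Sum>k. 1 / (\<nu> k)\<^sup>2\<close> converges.
\<close>

lemma node_product_moments_bounded: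
  assumes shift: "shift_assumption x0 \<phi>"
    and F: "real_distribution F" "finite_moments F"
    and dens: "has_density_on F f (outer_part x0)" and pos: "\<forall>x\<in>outer_part x0. 0 < f x"
    and lim: "Limsup at_infinity (\<lambda>x. ereal (f (x + rsign x * \<phi> \<bar>x\<bar>) / f x)) < 1"
  shows "\<exists>A>0. \<exists>B. \<forall>N. (\<integral>x. node_product (\<lambda>k. A * log_node k) N x \<partial>F) \<le> B"
proof -
  interpret real_distribution F by fact
  have x0: "0 < x0" and \<phi>0: "\<And>x. x0 \<le> x \<Longrightarrow> 0 \<le> \<phi> x"
    using shift by (auto simp: shift_assumption_def)
  obtain c where c: "Limsup at_infinity (\<lambda>x. ereal (f (x + rsign x * \<phi> \<bar>x\<bar>) / f x)) < ereal c" "ereal c < 1"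
    using ereal_dense2[OF lim] by blast
  define q where "q = max c (1 / 2)"
  have q: "0 < q" "q < 1" "c \<le> q" using c(2) by (auto simp: q_def one_ereal_def)
  obtain b where b: "\<And>x. b \<le> \<bar>x\<bar> \<Longrightarrow> f (x + rsign x * \<phi> \<bar>x\<bar>) / f x < c"
    using Limsup_lessD[OF c(1)] by (auto simp: eventually_at_infinity)
  have ratio: "f (x + rsign x * \<phi> \<bar>x\<bar>) \<le> q * f x" if "b \<le> \<bar>x\<bar>" "x0 \<le> \<bar>x\<bar>" for x
  proof -
    have "x \<in> outer_part x0" using that(2) by (auto simp: outer_part_def)
    then have "0 < f x" using pos by blast
    moreover have "f (x + rsign x * \<phi> \<bar>x\<bar>) / f x \<le> q" using b[OF that(1)] q by simp
    ultimately show ?thesis by (simp add: pos_divide_le_eq)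
  qed
  have ratio_pos: "f (x + \<phi> x) \<le> q * f x" if "b \<le> x" "x0 \<le> x" for x
    using ratio[of x] that x0 by (simp add: rsign_def)
  have ratio_neg: "f (- (x + \<phi> x)) \<le> q * f (- x)" if "b \<le> x" "x0 \<le> x" for x
    using ratio[of "- x"] that x0 by (simp add: rsign_def)
  let ?G = "distr F borel uminus"
  have G: "real_distribution ?G" by simp
  have Gm: "finite_moments ?G"
    using F(2) unfolding finite_moments_def by (simp add: integrable_distr_eq)
  have posG: "\<forall>x\<in>outer_part x0. 0 < f (- x)" using pos by (auto simp: outer_part_def)
  have "\<exists>A1. \<forall>A\<ge>A1. \<exists>x1 B. \<forall>N. (\<integral>x. indicator {x1..} x * node_product (\<lambda>k. A * log_node k) N x \<partial>F) \<le> B"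
    by (rule node_product_tail_bounded[OF shift F dens pos q(1,2)], rule ratio_pos)
  then obtain A1 where A1: "\<forall>A\<ge>A1. \<exists>x1 B. \<forall>N. (\<integral>x. indicator {x1..} x * node_product (\<lambda>k. A * log_node k) N x \<partial>F) \<le> B" ..
  have "\<exists>A2. \<forall>A\<ge>A2. \<exists>x1 B. \<forall>N. (\<integral>x. indicator {x1..} x * node_product (\<lambda>k. A * log_node k) N x \<partial>?G) \<le> B"
    by (rule node_product_tail_bounded[OF shift G Gm has_density_on_uminus[OF F(1) dens] posG q(1,2)], rule ratio_neg)
  then obtain A2 where A2: "\<forall>A\<ge>A2. \<exists>x1 B. \<forall>N. (\<integral>x. indicator {x1..} x * node_product (\<lambda>k. A * log_node k) N x \<partial>?G) \<le> B" ..
  define A where "A = max 1 (max A1 A2)"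
  have A: "0 < A" "A1 \<le> A" "A2 \<le> A" by (auto simp: A_def)
  let ?\<nu> = "\<lambda>k. A * log_node k"
  obtain x1 B1 where B1: "\<And>N. (\<integral>x. indicator {x1..} x * node_product ?\<nu> N x \<partial>F) \<le> B1"
    using A1 A(2) by blast
  obtain x2 B2 where B2: "\<And>N. (\<integral>x. indicator {x2..} x * node_product ?\<nu> N x \<partial>?G) \<le> B2"
    using A2 A(3) by blast
  define R where "R = max \<bar>x1\<bar> \<bar>x2\<bar>"
  define K where "K = exp (R\<^sup>2 * (\<Sum>k. 1 / (?\<nu> k)\<^sup>2))"
  have "(\<integral>x. node_product ?\<nu> N x \<partial>F) \<le> K + B1 + B2" for N
  proof -
    let ?W = "node_product ?\<nu> N"
    have W: "integrable F ?W" by (rule integrable_node_product[OF F])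
    have W0: "0 \<le> ?W x" for x by (rule order_trans[OF zero_le_one node_product_ge_1])
    have i1: "integrable F (\<lambda>x. indicator {x1..} x * ?W x)"
      using integrable_mult_indicator[OF _ W, of "{x1..}"] by simp
    have i2: "integrable F (\<lambda>x. indicator {x2..} (- x) * ?W x)"
    proof -
      have "indicator {x2..} (- x) = (indicator {..- x2} x :: real)" for x
        by (auto simp: indicator_def)
      then show ?thesis using integrable_mult_indicator[OF _ W, of "{..- x2}"] by simp
    qed
    have "(\<integral>x. ?W x \<partial>F) \<le> (\<integral>x. K + indicator {x1..} x * ?W x + indicator {x2..} (- x) * ?W x \<partial>F)"
    proof (intro integral_mono W Bochner_Integration.integrable_add i1 i2)
      fix x
      have "?W R \<le> K"
        unfolding K_def by (rule node_product_le_exp[OF summable_inverse_square_scaled_log_node])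
      moreover have "?W x \<le> ?W R" if "\<not> x1 \<le> x" "\<not> x2 \<le> - x"
        using that by (intro node_product_mono) (auto simp: R_def)
      moreover have "0 \<le> K" by (simp add: K_def)
      ultimately show "?W x \<le> K + indicator {x1..} x * ?W x + indicator {x2..} (- x) * ?W x"
        using W0[of x] by (auto simp: indicator_def)
    qed simp
    also have "\<dots> = K + (\<integral>x. indicator {x1..} x * ?W x \<partial>F) + (\<integral>x. indicator {x2..} (- x) * ?W x \<partial>F)"
      using i1 i2 prob_space by simp
    also have "(\<integral>x. indicator {x2..} (- x) * ?W x \<partial>F) = (\<integral>x. indicator {x2..} x * ?W x \<partial>?G)"
      by (subst integral_distr) auto
    also have "K + (\<integral>x. indicator {x1..} x * ?W x \<partial>F) + (\<integral>x. indicator {x2..} x * ?W x \<partial>?G) \<le> K + B1 + B2"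
      by (intro add_mono B1 B2 order_refl)
    finally show ?thesis .
  qed
  with A(1) show ?thesis by blast
qed

lemma even_moment_pos:
  assumes F: "real_distribution F" "finite_moments F"
    and dens: "has_density_on F f (outer_part x0)" and pos: "\<forall>x\<in>outer_part x0. 0 < f x" and x0: "0 < x0"
  shows "0 < (\<integral>x. x ^ (2 * n) \<partial>F)"
proof (rule ccontr)
  interpret real_distribution F by fact
  assume "\<not> 0 < (\<integral>x. x ^ (2 * n) \<partial>F)"
  then have "(\<integral>x. x ^ (2 * n) \<partial>F) = 0" by (simp add: order_antisym)
  then have "AE x in F. x ^ (2 * n) = 0"
    using integral_nonneg_eq_0_iff_AE[OF integrable_power_if_finite_moments[OF F, of "2 * n"]] by simp
  then have "AE x in F. x \<notin> {x0..}"
    by eventually_elim (use x0 in auto)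
  then have "emeasure F {x0..} = 0" by (subst (asm) AE_iff_null_sets[symmetric]) auto
  moreover have sub: "{x0..} \<subseteq> outer_part x0" using x0 by (auto simp: outer_part_def)
  ultimately have "(\<integral>\<^sup>+x\<in>{x0..}. ennreal (f x) \<partial>lborel) = 0"
    using dens by (simp add: has_density_on_def)
  moreover have "(\<lambda>x. ennreal (f x) * indicator {x0..} x) \<in> borel_measurable lborel"
  proof -
    have [measurable]: "(\<lambda>x. indicator (outer_part x0) x *\<^sub>R f x) \<in> borel_measurable borel"
      using dens by (simp add: has_density_on_def set_borel_measurable_def)
    have "(\<lambda>x. ennreal (indicator (outer_part x0) x *\<^sub>R f x) * indicator {x0..} x) \<in> borel_measurable lborel"
      by measurable
    also have "(\<lambda>x. ennreal (indicator (outer_part x0) x *\<^sub>R f x) * indicator {x0..} x)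
        = (\<lambda>x. ennreal (f x) * indicator {x0..} x)"
      using sub by (auto simp: indicator_def fun_eq_iff)
    finally show ?thesis .
  qed
  ultimately have "AE x in lborel. ennreal (f x) * indicator {x0..} x = 0"
    by (simp add: nn_integral_0_iff_AE)
  moreover have "0 < f x" if "x0 \<le> x" for x using pos sub that by auto
  ultimately have "AE x in lborel. x \<notin> {x0..x0 + 1}"
    by (elim eventually_mono) (force simp: indicator_def ennreal_eq_0_iff)
  then have "emeasure lborel {x0..x0 + 1} = 0" by (subst (asm) AE_iff_null_sets[symmetric]) auto
  then show False by simp
qed

theorem theorem1:
  fixes M :: "'a measure" and X :: "'a \<Rightarrow> real"
    and x0 :: real and \<phi> f :: "real \<Rightarrow> real"
  assumes "x0 > 0"
    and "shift_assumption x0 \<phi>"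
    and "prob_space M"
    and "X \<in> borel_measurable M"
    and "\<forall>n\<ge>1. integrable M (\<lambda>\<omega>. \<bar>X \<omega>\<bar> ^ n)"
    and "has_density_on (distr M borel X) f (outer_part x0)"
    and "\<forall>x\<in>outer_part x0. f x > 0"
    and "Limsup at_infinity (\<lambda>x. ereal (f (x + rsign x * \<phi> \<bar>x\<bar>) / f x)) < 1"
  shows "carleman_condition M X \<and>
         M_det_on UNIV M X \<and>
         M_det_on UNIV M (\<lambda>\<omega>. (X \<omega>)\<^sup>2) \<and> M_det_on {0..} M (\<lambda>\<omega>. (X \<omega>)\<^sup>2) \<and>
         M_det_on UNIV M (\<lambda>\<omega>. \<bar>X \<omega>\<bar>) \<and> M_det_on {0..} M (\<lambda>\<omega>. \<bar>X \<omega>\<bar>)"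
proof -
  interpret prob_space M by fact
  note [measurable] = assms(4)
  let ?F = "distr M borel X"
  have F: "real_distribution ?F" by simp
  have Fm: "finite_moments ?F"
    using assms(5) unfolding finite_moments_def by (simp add: integrable_distr_eq)
  obtain A B where A: "0 < A" and B: "\<And>N. (\<integral>x. node_product (\<lambda>k. A * log_node k) N x \<partial>?F) \<le> B"
    using node_product_moments_bounded[OF assms(2) F Fm assms(6,7,8)] by blast
  let ?\<nu> = "\<lambda>k. A * log_node k"
  have pos: "0 < ?\<nu> k" for k using A log_node_pos by simp
  have mono: "?\<nu> i \<le> ?\<nu> j" if "i \<le> j" for i j using A log_node_mono[OF that] by simp
  have div: "\<not> summable (\<lambda>k. 1 / ?\<nu> k)"
  proof
    assume "summable (\<lambda>k. 1 / ?\<nu> k)"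
    from summable_mult[OF this, of A] have "summable (\<lambda>k. 1 / log_node k)" using A by simp
    with sum_inverse_log_node_not_summable show False by simp
  qed
  have carl: "carleman_condition ?F (\<lambda>x. x)"
    by (rule carleman_if_node_product_bounded[OF F Fm pos mono div B even_moment_pos[OF F Fm assms(6,7,1)]])
  have sq: "distr M borel (\<lambda>\<omega>. (X \<omega>)\<^sup>2) = distr ?F borel (\<lambda>x. x\<^sup>2)"
    by (subst distr_distr) (auto simp: comp_def)
  have ab: "distr M borel (\<lambda>\<omega>. \<bar>X \<omega>\<bar>) = distr ?F borel (\<lambda>x. \<bar>x\<bar>)"
    by (subst distr_distr) (auto simp: comp_def)
  have 1: "M_det_on UNIV M X"
    unfolding M_det_on_def by (rule M_det_distr_if_node_product_bounded[OF F Fm pos div B])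
  have 2: "M_det_on UNIV M (\<lambda>\<omega>. (X \<omega>)\<^sup>2)"
    unfolding M_det_on_def sq
    by (rule M_det_distr_power2_if_node_product_bounded[OF F Fm pos div summable_inverse_square_scaled_log_node B])
  have 3: "M_det_on UNIV M (\<lambda>\<omega>. \<bar>X \<omega>\<bar>)"
    unfolding M_det_on_def ab by (rule M_det_distr_abs_if_node_product_bounded[OF F Fm pos div B])
  have nn: "AE x in distr M borel (\<lambda>\<omega>. (X \<omega>)\<^sup>2). x \<in> {0..}" "AE x in distr M borel (\<lambda>\<omega>. \<bar>X \<omega>\<bar>). x \<in> {0..}"
    by (subst AE_distr_iff; auto)+
  have "carleman_condition M X"
    using carl unfolding carleman_condition_def by (subst (asm) integral_distr) auto
  with 1 2 3 M_det_distr_restrict[OF 2[unfolded M_det_on_def] nn(1)] M_det_distr_restrict[OF 3[unfolded M_det_on_def] nn(2)]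
  show ?thesis by (simp add: M_det_on_def)
qed

end
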